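(* Let $G$ be an $n$-cycle ($n\ge 3$). (a) If $n$ is even, there is a polynomial-time algorithm which, given any initial configuration $C$ on $G$, finds a solution of the parallel token swapping problem $(G,C)$ with value at most $2\,OPT$. (b) If $n$ is odd, there is a polynomial-time algorithm which, given any initial configuration $C$ on $G$, finds a solution of the parallel token swapping problem $(G,C)$ with value at most $2\,OPT+1$. Here $OPT=OPT(G,C)$ is the optimal solution value of the given instance.
   Context: Let $G=(V,E)$ be a finite connected undirected simple graph. The token set $T$ is a copy of $V$. A configuration is a bijection $C:V\to T$ ($C(v)$ is the token lying on vertex $v$); $Id$ is the canonical identity bijection. A matching $M\subseteq E$ routes a configuration $C$ to the configuration $MC$ given by $MC(v)=C(w)$ if $(v,w)\in M$, and $MC(v)=C(v)$ if $v$ is not covered by $M$. The parallel token swapping problem: given $(G,C)$, a solution is a sequence of matchings $(M_1,\ldots,M_k)$ of $G$ such that $M_k\cdots M_1C=Id$; its value (size) is $k$, and $OPT(G,C)$ is the minimum value of a solution. The $n$-cycle has vertex set $\{1,\ldots,n\}$ and edges $(i,i+1)$ for $1\le i\le n$, with $n+1$ identified with $1$. *)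

theory Defs
  imports
    Complex_Main
    "HOL-Library.Discrete_Functions"
    "HOL-Computational_Algebra.Polynomial"
begin

section \<open>Parallel token swapping\<close>

definition is_matching :: "'a set set \<Rightarrow> 'a set set \<Rightarrow> bool" where
  "is_matching E M \<longleftrightarrow> M \<subseteq> E \<and> pairwise disjnt M"

text \<open>The token set is taken to be the vertex set itself, so that the identity configuration
  is the identity function on the vertices.\<close>

definition is_configuration :: "'a set \<Rightarrow> ('a \<Rightarrow> 'a) \<Rightarrow> bool" where
  "is_configuration V C \<longleftrightarrow> bij_betw C V V"

definition route :: "'a set set \<Rightarrow> ('a \<Rightarrow> 'a) \<Rightarrow> ('a \<Rightarrow> 'a)" where
  "route M C = (\<lambda>v. if v \<in> \<Union>M then C (THE w. {v, w} \<in> M) else C v)"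

text \<open>The head of the list is the matching that is applied first.\<close>

definition is_solution :: "'a set \<Rightarrow> 'a set set \<Rightarrow> ('a \<Rightarrow> 'a) \<Rightarrow> 'a set set list \<Rightarrow> bool" where
  "is_solution V E C Ms \<longleftrightarrow>
     (\<forall>M \<in> set Ms. is_matching E M) \<and> (\<forall>v \<in> V. fold route Ms C v = v)"

definition OPT :: "'a set \<Rightarrow> 'a set set \<Rightarrow> ('a \<Rightarrow> 'a) \<Rightarrow> nat" where
  "OPT V E C = (LEAST k. \<exists>Ms. is_solution V E C Ms \<and> length Ms = k)"

definition cycle_vertices :: "nat \<Rightarrow> nat set" where
  "cycle_vertices n = {1..n}"

definition cycle_edge :: "nat \<Rightarrow> nat \<Rightarrow> nat set" where
  "cycle_edge n i = {i, if i = n then 1 else i + 1}"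

definition cycle_edges :: "nat \<Rightarrow> nat set set" where
  "cycle_edges n = cycle_edge n ` {1..n}"


section \<open>A machine model for polynomial time\<close>

text \<open>
  Algorithms are programs of a structured random access machine. The memory consists of finitely
  many (those named in the program) registers holding natural numbers and finitely many unbounded
  arrays of natural numbers.  Every executed command (assignment, array write, evaluation of a
  branching or loop condition) costs one unit.

  The only arithmetic operations are addition and truncated subtraction.  Hence the bit length of
  every number in memory grows by at most a constant (depending on the program) per step, and the
  functions computed in polynomial time, measured against the bit length of the input, are the
  ones computed in polynomial time by Turing machines; a unit-cost multiplication would
  destroy this.  As expressions are part of the fixed program, charging for every operation
  in an expression would change running times by a constant factor only.
\<close>

type_synonym name = string

datatype aexp =
    Const nat
  | Reg name
  | Cell name aexp
  | Add aexp aexp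
  | Monus aexp aexp

datatype bexp =
    Less aexp aexp
  | Equal aexp aexp
  | Neg bexp
  | Conj bexp bexp

datatype com =
    Skip
  | Assign name aexp
  | Store name aexp aexp
  | Seq com com
  | Cond bexp com com
  | While bexp com

record memory =
  reg :: "name \<Rightarrow> nat"
  arr :: "name \<Rightarrow> nat \<Rightarrow> nat"

primrec aval :: "aexp \<Rightarrow> memory \<Rightarrow> nat" where
  "aval (Const k) s = k"
| "aval (Reg x) s = reg s x"
| "aval (Cell a e) s = arr s a (aval e s)"
| "aval (Add e f) s = aval e s + aval f s"
| "aval (Monus e f) s = aval e s - aval f s"

primrec bval :: "bexp \<Rightarrow> memory \<Rightarrow> bool" where
  "bval (Less e f) s \<longleftrightarrow> aval e s < aval f s"
| "bval (Equal e f) s \<longleftrightarrow> aval e s = aval f s"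
| "bval (Neg b) s \<longleftrightarrow> \<not> bval b s"
| "bval (Conj b c) s \<longleftrightarrow> bval b s \<and> bval c s"

definition set_reg :: "name \<Rightarrow> nat \<Rightarrow> memory \<Rightarrow> memory" where
  "set_reg x k s = s\<lparr>reg := (reg s)(x := k)\<rparr>"

definition set_cell :: "name \<Rightarrow> nat \<Rightarrow> nat \<Rightarrow> memory \<Rightarrow> memory" where
  "set_cell a i k s = s\<lparr>arr := (arr s)(a := (arr s a)(i := k))\<rparr>"

text \<open>\<open>exec c s t s'\<close>: started in memory \<open>s\<close>, program \<open>c\<close> terminates after
  \<open>t\<close> steps in memory \<open>s'\<close>.\<close>

inductive exec :: "com \<Rightarrow> memory \<Rightarrow> nat \<Rightarrow> memory \<Rightarrow> bool" where
  exec_Skip: "exec Skip s 1 s"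
| exec_Assign: "exec (Assign x e) s 1 (set_reg x (aval e s) s)"
| exec_Store: "exec (Store a e f) s 1 (set_cell a (aval e s) (aval f s) s)"
| exec_Seq: "exec c1 s t1 s' \<Longrightarrow> exec c2 s' t2 s'' \<Longrightarrow> exec (Seq c1 c2) s (t1 + t2) s''"
| exec_CondT: "bval b s \<Longrightarrow> exec c1 s t s' \<Longrightarrow> exec (Cond b c1 c2) s (t + 1) s'"
| exec_CondF: "\<not> bval b s \<Longrightarrow> exec c2 s t s' \<Longrightarrow> exec (Cond b c1 c2) s (t + 1) s'"
| exec_WhileF: "\<not> bval b s \<Longrightarrow> exec (While b c) s 1 s"
| exec_WhileT: "bval b s \<Longrightarrow> exec c s t1 s' \<Longrightarrow> exec (While b c) s' t2 s'' \<Longrightarrow>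
    exec (While b c) s (t1 + t2 + 1) s''"


lemma exec_deterministic:
  "exec c s t s' \<Longrightarrow> exec c s u v \<Longrightarrow> u = t \<and> v = s'"
proof (induction arbitrary: u v rule: exec.induct)
  case exec_Skip
  then show ?case by (auto elim: exec.cases)
next
  case exec_Assign
  then show ?case by (auto elim: exec.cases)
next
  case exec_Store
  then show ?case by (auto elim: exec.cases)
next
  case (exec_Seq c1 s t1 s' c2 t2 s'')
  from exec_Seq.prems obtain u1 r u2
    where "u = u1 + u2" "exec c1 s u1 r" "exec c2 r u2 v"
    by (cases rule: exec.cases) auto
  with exec_Seq.IH(1)[of u1 r] exec_Seq.IH(2)[of u2 v] show ?case by simp
next
  case (exec_CondT b s c1 t s' c2)
  from exec_CondT.prems exec_CondT.hyps(1) obtain u1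
    where "u = u1 + 1" "exec c1 s u1 v" by (cases rule: exec.cases) auto
  with exec_CondT.IH[of u1 v] show ?case by simp
next
  case (exec_CondF b s c2 t s' c1)
  from exec_CondF.prems exec_CondF.hyps(1) obtain u1
    where "u = u1 + 1" "exec c2 s u1 v" by (cases rule: exec.cases) auto
  with exec_CondF.IH[of u1 v] show ?case by simp
next
  case (exec_WhileF b s c)
  from exec_WhileF.prems exec_WhileF.hyps show ?case by (cases rule: exec.cases) auto
next
  case (exec_WhileT b s c t1 s' t2 s'')
  from exec_WhileT.prems exec_WhileT.hyps(1) obtain u1 r u2
    where "u = u1 + u2 + 1" "exec c s u1 r" "exec (While b c) r u2 v"
    by (cases rule: exec.cases) auto
  with exec_WhileT.IH(1)[of u1 r] exec_WhileT.IH(2)[of u2 v] show ?case by simp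
qed

text \<open>Inputs and outputs are lists of numbers.  All memory outside the input is initially 0.\<close>

definition input_memory :: "nat list \<Rightarrow> memory" where
  "input_memory xs =
     \<lparr>reg = (\<lambda>_. 0)(''inlen'' := length xs),
      arr = (\<lambda>_ _. 0)(''in'' := (\<lambda>i. if i < length xs then xs ! i else 0))\<rparr>"

definition output_list :: "memory \<Rightarrow> nat list" where
  "output_list s = map (arr s ''out'') [0..<reg s ''outlen'']"

definition computes_in :: "com \<Rightarrow> nat list \<Rightarrow> nat list \<Rightarrow> nat \<Rightarrow> bool" where
  "computes_in A xs ys t \<longleftrightarrow> (\<exists>s. exec A (input_memory xs) t s \<and> output_list s = ys)"

text \<open>The total number of binary digits: \<open>floor_log x + 1\<close> is the length of
  the binary representation of \<open>x\<close>, where 0 counts as one digit.\<close>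

definition input_size :: "nat list \<Rightarrow> nat" where
  "input_size xs = (\<Sum>x\<leftarrow>xs. floor_log x + 1)"

text \<open>A promise version: only the elements of \<open>I\<close> have to be handled, and \<open>R\<close> relates each
  of them to its admissible outputs.  The polynomial is uniform in the input.\<close>

definition poly_time_algorithm ::
    "com \<Rightarrow> ('i \<Rightarrow> nat list) \<Rightarrow> 'i set \<Rightarrow> ('i \<Rightarrow> nat list \<Rightarrow> bool) \<Rightarrow> bool" where
  "poly_time_algorithm A enc I R \<longleftrightarrow>
     (\<exists>p :: nat poly. \<forall>x \<in> I. \<exists>ys t.
        computes_in A (enc x) ys t \<and> t \<le> poly p (input_size (enc x)) \<and> R x ys)"


section \<open>Instances and solutions on cycles as input and output\<close>

text \<open>An instance \<open>(n, C)\<close> is presented as \<open>C(1), \<dots>, C(n)\<close>, so the length of the list is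
  \<open>n\<close>.\<close>

definition encode_instance :: "nat \<times> (nat \<Rightarrow> nat) \<Rightarrow> nat list" where
  "encode_instance = (\<lambda>(n, C). map C [1..<n + 1])"

text \<open>A sequence of matchings of the \<open>n\<close>-cycle is written as the concatenation of blocks of
  length \<open>n\<close>, one for each matching, the \<open>i\<close>-th entry of a block
  telling whether the edge \<open>(i, i + 1)\<close> is in the matching.  For \<open>n \<ge> 3\<close> the
  \<open>n\<close> edges are distinct and the encoding is injective on sequences of matchings.\<close>

definition encode_matching :: "nat \<Rightarrow> nat set set \<Rightarrow> nat list" where
  "encode_matching n M = map (\<lambda>i. if cycle_edge n i \<in> M then 1 else 0) [1..<n + 1]"

definition encode_solution :: "nat \<Rightarrow> nat set set list \<Rightarrow> nat list" where
  "encode_solution n Ms = concat (map (encode_matching n) Ms)"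

end

theory Submission
  imports Defs
begin

text \<open>
  Lift a configuration to a map \<open>F\<close> on the integers with \<open>F (i + n) = F i + n\<close>, positions and
  targets counted from 0; choosing a lift means choosing a direction of travel for every token.
  A solution of length \<open>k\<close> yields a lift whose displacements \<open>F i - i\<close> have absolute value at
  most \<open>k\<close> and sum to 0 over a period.  Hence if \<open>2 * k < n\<close>, every token has to travel the
  shorter way, and the shortest displacements sum to 0.

  So if the shortest displacements sum to 0, take that lift, let \<open>D \<le> OPT\<close> be its largest
  displacement and \<open>L = 2 * D\<close>; otherwise \<open>2 * OPT \<ge> n\<close>, and one takes the lift
  that never uses the edge \<open>(n, 1)\<close>, with \<open>L = n\<close>.  In both cases, for every threshold \<open>k\<close> the 0-1
  sequence \<open>k \<le> F i\<close> is already sorted outside some window of length \<open>L\<close>, and odd-even transposition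
  sort around the cycle sorts such a window in \<open>L\<close> rounds, or \<open>L + 1\<close> rounds if \<open>n\<close> is odd.  A
  sorted lift with zero total displacement is the identity.
\<close>

section \<open>Odd-even transposition sort on a cycle\<close>

definition swapped :: "(int \<Rightarrow> bool) \<Rightarrow> (int \<Rightarrow> int) \<Rightarrow> int \<Rightarrow> bool" where
  "swapped A F i \<longleftrightarrow> A i \<and> F (i + 1) < F i"

definition compare_swap :: "(int \<Rightarrow> bool) \<Rightarrow> (int \<Rightarrow> int) \<Rightarrow> int \<Rightarrow> int" where
  "compare_swap A F i =
     (if swapped A F i then F (i + 1) else if swapped A F (i - 1) then F (i - 1) else F i)"

text \<open>Edge \<open>i\<close> joins the positions \<open>i\<close> and \<open>i + 1\<close>.  If \<open>n\<close> is odd, both \<open>0\<close> and \<open>n - 1\<close> are even, so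
  that adjacent edges are never active in the same round for odd \<open>n\<close> either; the price is that each
  edge pauses for one additional round in every \<open>n\<close> rounds.\<close>

definition active :: "int \<Rightarrow> nat \<Rightarrow> int \<Rightarrow> bool" where
  "active n t i \<longleftrightarrow> odd ((i + int t) mod n)"

primrec sweep :: "int \<Rightarrow> (int \<Rightarrow> int) \<Rightarrow> nat \<Rightarrow> int \<Rightarrow> int" where
  "sweep n F 0 = F"
| "sweep n F (Suc t) = compare_swap (active n t) (sweep n F t)"

text \<open>The schedule as a growing surface: neighbouring heights differ by 1, the active edges are local
  minima, and being active raises an edge by 2.  For odd \<open>n\<close> such a surface cannot be periodic; it
  drops by 1 per turn around the cycle.\<close>

definition height :: "int \<Rightarrow> nat \<Rightarrow> int \<Rightarrow> int" where
  "height n t i = int t - (n mod 2) * ((i + int t) div n) - ((i + int t) mod n) mod 2"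

definition ones :: "int \<Rightarrow> (int \<Rightarrow> int) \<Rightarrow> int \<Rightarrow> nat \<Rightarrow> int" where
  "ones k F a u = (\<Sum>j<u. of_bool (k \<le> F (a + int j)))"

section \<open>Local slope and growth of the surface \<open>height\<close>\<close>

lemma mod_add_one:
  fixes y n :: int
  assumes "n > 0"
  shows "y mod n + 1 < n \<and> (y + 1) mod n = y mod n + 1 \<and> (y + 1) div n = y div n \<or>
         y mod n + 1 = n \<and> (y + 1) mod n = 0 \<and> (y + 1) div n = y div n + 1"
proof -
  have y: "y = n * (y div n) + y mod n" by simp
  have lt: "y mod n < n" "0 \<le> y mod n" using assms by simp_all
  show ?thesis
  proof (cases "y mod n + 1 = n")
    case True
    have "n * (y div n + 1) = n * (y div n) + n" by (simp add: distrib_left)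
    then have e: "y + 1 = n * (y div n + 1)" using y True by linarith
    have "(y + 1) mod n = 0" "(y + 1) div n = y div n + 1"
      by (subst e, simp, subst e, use assms in simp)
    then show ?thesis using True by simp
  next
    case False
    then have r: "y mod n + 1 < n" using lt by simp
    have e: "y + 1 = (y mod n + 1) + n * (y div n)" using y by linarith
    have "(y + 1) mod n = (y mod n + 1) mod n" by (subst e) (rule mod_mult_self2)
    moreover have "(y + 1) div n = y div n + (y mod n + 1) div n"
      by (subst e) (use assms in \<open>simp only: div_mult_self2\<close>)
    ultimately show ?thesis using r lt by simp
  qed
qed

text \<open>Where the residue wraps from \<open>n - 1\<close> to 0, the edge is active iff
  \<open>n\<close> is even, and exactly for odd \<open>n\<close> the \<open>div\<close> term
  contributes a drop of 1. Hence activity alone decides the slope, with no exception at the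
  seam.\<close>

lemma height_right:
  assumes "n > 0"
  shows "height n t (i + 1) = height n t i + (if active n t i then 1 else - 1)"
proof -
  have e: "i + 1 + int t = (i + int t) + 1" by simp
  have "n mod 2 = (if even n then 0 else 1)" by (simp add: mod2_eq_if)
  moreover have "(i + int t) mod n + 1 = n \<Longrightarrow> even n \<longleftrightarrow> odd ((i + int t) mod n)"
    by (metis even_plus_one_iff)
  ultimately show ?thesis using mod_add_one[OF assms, of "i + int t"]
    unfolding height_def active_def e by (auto simp: mod2_eq_if algebra_simps)
qed

text \<open>Apart from the leading \<open>int t\<close>, only \<open>i + int t\<close> enters, so
  one round later is the same as one step to the right, plus 1.\<close>

lemma height_Suc:
  assumes "n > 0"
  shows "height n (Suc t) i = height n t i + (if active n t i then 2 else 0)"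
proof -
  have "height n (Suc t) i = height n t (i + 1) + 1"
    unfolding height_def by (simp add: algebra_simps)
  then show ?thesis using height_right[OF assms, of t i] by simp
qed

lemma active_not_pred:
  assumes "n > 0" "active n t i"
  shows "\<not> active n t (i - 1)"
  using mod_add_one[OF assms(1), of "i - 1 + int t"] assms(2)
  unfolding active_def by (auto simp: algebra_simps)

lemma height_left:
  assumes "n > 0" "active n t i"
  shows "height n t (i - 1) = height n t i + 1"
  using height_right[OF assms(1), of t "i - 1"] active_not_pred[OF assms] by simp

lemma height_lipschitz:
  assumes "n > 0"
  shows "\<bar>height n t i - height n t j\<bar> \<le> \<bar>i - j\<bar>"
proof -
  have *: "\<bar>height n t (j + int m) - height n t j\<bar> \<le> int m" for m j
  proof (induction m)
    case (Suc m)
    show ?case using Suc height_right[OF assms, of t "j + int m"]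
      by (simp add: algebra_simps split: if_splits)
  qed simp
  show ?thesis
  proof (cases "j \<le> i")
    case True
    then show ?thesis using *[of j "nat (i - j)"] by simp
  next
    case False
    then show ?thesis using *[of i "nat (j - i)"] by simp
  qed
qed

section \<open>Counts of ones under compare-and-swap (the 0-1 principle)\<close>

lemma ones_0 [simp]: "ones k F a 0 = 0"
  and ones_Suc [simp]: "ones k F a (Suc u) = ones k F a u + of_bool (k \<le> F (a + int u))"
  by (simp_all add: ones_def)

lemma ones_nonneg: "0 \<le> ones k F a u"
  by (simp add: ones_def sum_nonneg)

lemma ones_le: "u \<le> v \<Longrightarrow> ones k F a u \<le> ones k F a v \<and> ones k F a v \<le> ones k F a u + int (v - u)"
  by (induction v rule: dec_induct) (auto simp: Suc_diff_le)

text \<open>Only the edge crossing the right end of the prefix can change the count: edges inside it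
  permute its entries, and at the left end a swap with \<open>F (a - 1) < k\<close> exchanges two
  zeros. A swap of two values on the same side of \<open>k\<close> is invisible.\<close>

lemma ones_compare_swap:
  assumes "\<And>i. A i \<Longrightarrow> \<not> A (i - 1)" and "F (a - 1) < k"
  shows "ones k (compare_swap A F) a u =
    ones k F a u - of_bool (A (a + int u - 1) \<and> k \<le> F (a + int u - 1) \<and> F (a + int u) < k)"
proof (induction u)
  case 0
  then show ?case using assms(2) by simp
next
  case (Suc u)
  have "A (a + int u) \<Longrightarrow> \<not> A (a + int u - 1)" by (rule assms)
  moreover have "a + (1 + int u) = a + int u + 1" "a + int u - 1 + 1 = a + int u" by simp_all
  ultimately show ?case using Suc
    by (auto simp: compare_swap_def swapped_def of_bool_def algebra_simps split: if_splits)
qed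

lemma compare_swap_lower:
  assumes "\<forall>i<a. F i < k"
  shows "\<forall>i<a. compare_swap A F i < k"
proof (intro allI impI)
  fix i assume "i < a"
  then have "F i < k" "F (i - 1) < k" using assms by auto
  then show "compare_swap A F i < k" by (auto simp: compare_swap_def swapped_def)
qed

lemma compare_swap_upper:
  assumes "\<forall>i\<ge>b. k \<le> F i"
  shows "\<forall>i\<ge>b. k \<le> compare_swap A F i"
proof (intro allI impI)
  fix i assume "i \<ge> b"
  then have "k \<le> F i" "k \<le> F (i + 1)" using assms by auto
  then show "k \<le> compare_swap A F i"
    by (auto simp: compare_swap_def swapped_def)
qed

lemma sweep_window:
  assumes "\<forall>i<a. F i < k" "\<forall>i\<ge>b. k \<le> F i"
  shows "\<forall>i<a. sweep n F t i < k" "\<forall>i\<ge>b. k \<le> sweep n F t i"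
proof (induction t)
  case 0
  { case 1 show ?case using assms by simp }
  { case 2 show ?case using assms by simp }
next
  case (Suc t)
  { case 1 show ?case using compare_swap_lower[OF Suc.IH(1)] by simp }
  { case 2 show ?case using compare_swap_upper[OF Suc.IH(2)] by simp }
qed

lemma ones_sweep:
  assumes "n > 0" "\<forall>i<a. F i < k" "\<forall>i\<ge>a + int L. k \<le> F i"
  shows "ones k (sweep n F t) a L = ones k F a L"
proof (induction t)
  case (Suc t)
  have "sweep n F t (a - 1) < k" "k \<le> sweep n F t (a + int L)"
    using sweep_window[OF assms(2,3), of n t] by auto
  then show ?case using Suc ones_compare_swap[of "active n t" "sweep n F t" a k L]
      active_not_pred[OF assms(1)] by simp
qed simp

text \<open>An active edge replaces the number \<open>S u\<close> of ones to its left by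
  \<open>max (S (u - 1)) (S (u + 1) - 1)\<close>.  The bound is preserved by this dynamics: the first term is the
  sorted state, the second one is the motion of the worst initial state (all \<open>p\<close> ones to the left of
  all zeros) before it feels the ends of the window.\<close>

lemma ones_bound:
  fixes L :: nat and F :: "int \<Rightarrow> int"
  assumes n: "n > 0" and win: "\<forall>i<a. F i < k" "\<forall>i\<ge>a + int L. k \<le> F i"
    and p: "p = ones k F a L" and u: "u \<le> L"
  shows "2 * ones k (sweep n F t) a u \<le>
    max (2 * max 0 (int u - (int L - p)))
        (p + int u - height n t (a - 1 + int u) + height n 0 (a - 1 + p))"
  using u
proof (induction t arbitrary: u)
  case 0
  \<comment> \<open>Initially the count is at most the minimum of \<open>p\<close> and
    \<open>u\<close>, twice of which is \<open>p + u - \<bar>u - p\<bar>\<close>; the Lipschitz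
    bound on the initial surface turns this into the second term of the maximum.\<close>
  have "ones k F a u \<le> p" using ones_le[of u L k F a] 0 p by simp
  moreover have "ones k F a u \<le> int u" using ones_le[of 0 u k F a] by simp
  moreover have "\<bar>height n 0 (a - 1 + int u) - height n 0 (a - 1 + p)\<bar> \<le> \<bar>int u - p\<bar>"
    using height_lipschitz[OF n, of 0 "a - 1 + int u" "a - 1 + p"] by simp
  ultimately show ?case by simp
next
  case (Suc t)
  let ?F = "sweep n F t" and ?h = "height n t"
  have lo: "?F (a - 1) < k" using sweep_window[OF win, of n t] by auto
  have step: "ones k (sweep n F (Suc t)) a u = ones k ?F a u -
      of_bool (active n t (a + int u - 1) \<and> k \<le> ?F (a + int u - 1) \<and> ?F (a + int u) < k)"
    using ones_compare_swap[of "active n t" ?F a k u] active_not_pred[OF n] lo by simp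
  show ?case
  proof (cases "active n t (a - 1 + int u) \<and> 0 < u \<and> u < L")
    case False
    have "u = 0 \<or> u = L \<or> \<not> active n t (a - 1 + int u)" using False Suc.prems by auto
    then show ?thesis
    proof (elim disjE)
      assume "u = 0" then show ?thesis by (simp add: le_max_iff_disj)
    next
      assume "u = L"
      then show ?thesis using ones_sweep[OF n win, of "Suc t"] p by simp
    next
      assume na: "\<not> active n t (a - 1 + int u)"
      then have "\<not> active n t (a + int u - 1)" by (simp add: algebra_simps)
      then show ?thesis using Suc.IH[OF Suc.prems] na step height_Suc[OF n, of t "a - 1 + int u"] by simp
    qed
  next
    case True
    then obtain v where v: "u = Suc v" by (cases u) auto
    let ?i = "a - 1 + int u"
    have eq: "a + int u - 1 = ?i" by simp
    \<comment> \<open>Both neighbours of an active edge lie 1 above it, and the edge rises by 2. So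
      the second term for \<open>u - 1\<close>, and that for \<open>u + 1\<close> lowered by 2, both
      equal the one needed for \<open>u\<close> in the next round.\<close>
    have hs: "height n (Suc t) ?i = ?h ?i + 2" using height_Suc[OF n] True by simp
    have hr: "?h (a - 1 + int (Suc u)) = ?h ?i + 1"
      using height_right[OF n, of t ?i] True by (simp add: algebra_simps)
    have hl: "?h (a - 1 + int v) = ?h ?i + 1"
      using height_left[OF n, of t ?i] True v by (simp add: algebra_simps)
    have A: "ones k ?F a u = ones k ?F a v + of_bool (k \<le> ?F ?i)" using v by (simp add: algebra_simps)
    have B: "ones k ?F a (Suc u) = ones k ?F a u + of_bool (k \<le> ?F (a + int u))" by simp
    have Iv: "2 * ones k ?F a v \<le> max (2 * max 0 (int v - (int L - p)))
        (p + int v - (?h ?i + 1) + height n 0 (a - 1 + p))"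
      using Suc.IH[of v] hl v True by simp
    have Iu: "2 * ones k ?F a (Suc u) \<le> max (2 * max 0 (int (Suc u) - (int L - p)))
        (p + int (Suc u) - (?h ?i + 1) + height n 0 (a - 1 + p))"
      using Suc.IH[of "Suc u"] hr True by simp
    \<comment> \<open>Unless both ends of the edge carry ones, its left end carries a zero after the
      round, and the new count is that of the prefix shorter by one.\<close>
    show ?thesis
    proof (cases "k \<le> ?F ?i \<and> k \<le> ?F (a + int u)")
      case True
      then have "ones k (sweep n F (Suc t)) a u = ones k ?F a (Suc u) - 1"
        using step B by simp
      then show ?thesis using Iu hs by (simp add: max_def del: ones_Suc sweep.simps split: if_splits)
    next
      case False
      then have "ones k (sweep n F (Suc t)) a u = ones k ?F a v"
        using step A eq \<open>active n t (a - 1 + int u) \<and> 0 < u \<and> u < L\<close> by auto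
      then show ?thesis using Iv hs v by (simp add: max_def del: ones_Suc sweep.simps split: if_splits)
    qed
  qed
qed

text \<open>Assumption \<open>T\<close> makes the second term of \<open>ones_bound\<close> at most 1
  at the prefix length \<open>L - p\<close>. By the Lipschitz bound and
  \<open>d + \<bar>d\<bar> = 2 * max 0 d\<close>, it exceeds twice the sorted count by at most 1 at
  every other length, and integrality removes this excess. Conversely, the last \<open>L - u\<close>
  places hold at most \<open>L - u\<close> of the \<open>p\<close> ones, so no prefix has fewer ones
  than in the sorted state.\<close>

lemma sweep_threshold_sorted:
  fixes L :: nat
  assumes n: "n > 0" and win: "\<forall>i<a. F i < k" "\<forall>i\<ge>a + int L. k \<le> F i"
    and p: "p = ones k F a L"
    and T: "height n 0 (a - 1 + p) + int L - 1 \<le> height n T (a - 1 + (int L - p))"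
  shows "k \<le> sweep n F T i \<longleftrightarrow> a + int L - p \<le> i"
proof -
  let ?F = "sweep n F T"
  have pb: "0 \<le> p" "p \<le> int L" using ones_nonneg ones_le[of 0 L k F a] p by simp_all
  have eq: "ones k ?F a u = max 0 (int u - (int L - p))" if u: "u \<le> L" for u
  proof -
    have "\<bar>height n T (a - 1 + int u) - height n T (a - 1 + (int L - p))\<bar> \<le> \<bar>int u - (int L - p)\<bar>"
      using height_lipschitz[OF n, of T "a - 1 + int u" "a - 1 + (int L - p)"] by simp
    then have "2 * ones k ?F a u \<le> 2 * max 0 (int u - (int L - p)) + 1"
      using ones_bound[OF n win p u, of T] T by (simp add: max_def split: if_splits)
    moreover have "0 \<le> ones k ?F a u" by (rule ones_nonneg)
    moreover have "p \<le> ones k ?F a u + int (L - u)"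
      using ones_le[OF u, of k ?F a] ones_sweep[OF n win, of T] p by simp
    ultimately show ?thesis using u by (simp add: max_def split: if_splits)
  qed
  consider "i < a" | "a + int L \<le> i" | "a \<le> i" "i < a + int L" by linarith
  then show ?thesis
  proof cases
    case 1 then show ?thesis using sweep_window(1)[OF win, of n T] pb by auto
  next
    case 2 then show ?thesis using sweep_window(2)[OF win, of n T] pb by auto
  next
    case 3
    define u where "u = nat (i - a)"
    have u: "Suc u \<le> L" "i = a + int u" using 3 by (auto simp: u_def)
    have "of_bool (k \<le> ?F i) = ones k ?F a (Suc u) - ones k ?F a u" using u by simp
    also have "\<dots> = max 0 (int (Suc u) - (int L - p)) - max 0 (int u - (int L - p))"
      using eq[of u] eq[of "Suc u"] u by simp
    finally show ?thesis using u pb by (auto simp: max_def split: if_splits)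
  qed
qed

section \<open>Displacements of a solution\<close>

definition succ_vertex :: "nat \<Rightarrow> nat \<Rightarrow> nat" where
  "succ_vertex n v = (if v = n then 1 else v + 1)"

lemma cycle_edge_succ: "cycle_edge n i = {i, succ_vertex n i}"
  by (simp add: cycle_edge_def succ_vertex_def)

lemma succ_vertex_in: "v \<in> {1..n} \<Longrightarrow> succ_vertex n v \<in> {1..n}"
  by (auto simp: succ_vertex_def)

lemma bij_succ_vertex: "bij_betw (succ_vertex n) {1..n} {1..n}"
  by (rule bij_betw_byWitness[where f' = "\<lambda>v. if v = 1 then n else v - 1"])
    (auto simp: succ_vertex_def)

lemma succ_vertex_eqD: "i \<in> {1..n} \<Longrightarrow> j \<in> {1..n} \<Longrightarrow> succ_vertex n i = succ_vertex n j \<Longrightarrow> i = j"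
  using bij_succ_vertex by (metis bij_betw_def inj_onD)

lemma succ_vertex_neq: "n \<ge> 3 \<Longrightarrow> v \<in> {1..n} \<Longrightarrow>
   succ_vertex n v \<noteq> v \<and> succ_vertex n (succ_vertex n v) \<noteq> v"
  by (auto simp: succ_vertex_def)

section \<open>Routing along single edges of the cycle\<close>

lemma matching_disjoint:
  "is_matching E M \<Longrightarrow> e \<in> M \<Longrightarrow> f \<in> M \<Longrightarrow> x \<in> e \<Longrightarrow> x \<in> f \<Longrightarrow> e = f"
  by (auto simp: is_matching_def pairwise_def disjnt_iff)

lemma route_matched:
  assumes M: "is_matching E M" and e: "{v, w} \<in> M"
  shows "route M C v = C w"
proof -
  have "(THE w. {v, w} \<in> M) = w"
  proof (rule the_equality)
    show "{v, w} \<in> M" by (rule e)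
    fix u assume "{v, u} \<in> M"
    then have "{v, u} = {v, w}"
      using matching_disjoint[OF M _ e, of _ v] by simp
    then show "u = w" by (metis doubleton_eq_iff)
  qed
  then show ?thesis using e by (auto simp: route_def)
qed

lemma route_unmatched: "v \<notin> \<Union>M \<Longrightarrow> route M C v = C v"
  by (simp add: route_def)

lemma matching_cycle_succ:
  assumes n: "n \<ge> 3" and M: "is_matching (cycle_edges n) M" and v: "v \<in> {1..n}"
    and e: "cycle_edge n v \<in> M"
  shows "cycle_edge n (succ_vertex n v) \<notin> M"
proof
  assume e': "cycle_edge n (succ_vertex n v) \<in> M"
  have "succ_vertex n v \<in> cycle_edge n v \<inter> cycle_edge n (succ_vertex n v)"
    by (simp add: cycle_edge_succ)
  moreover have "cycle_edge n v \<noteq> cycle_edge n (succ_vertex n v)"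
    using succ_vertex_neq[OF n v] succ_vertex_neq[OF n succ_vertex_in[OF v]]
    unfolding cycle_edge_succ by (metis doubleton_eq_iff)
  ultimately show False
    using matching_disjoint[OF M e e'] by blast
qed

lemma route_cycle:
  assumes n: "n \<ge> 3" and M: "is_matching (cycle_edges n) M" and v: "v \<in> {1..n}"
  shows "cycle_edge n v \<in> M \<Longrightarrow> route M C v = C (succ_vertex n v)"
    and "cycle_edge n v \<in> M \<Longrightarrow> route M C (succ_vertex n v) = C v"
    and "cycle_edge n v \<notin> M \<Longrightarrow> cycle_edge n (succ_vertex n v) \<notin> M \<Longrightarrow>
      route M C (succ_vertex n v) = C (succ_vertex n v)"
proof -
  show "cycle_edge n v \<in> M \<Longrightarrow> route M C v = C (succ_vertex n v)"
    using route_matched[OF M] by (simp add: cycle_edge_succ)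
  show "cycle_edge n v \<in> M \<Longrightarrow> route M C (succ_vertex n v) = C v"
    using route_matched[OF M, of "succ_vertex n v" v] by (simp add: cycle_edge_succ insert_commute)
  show "route M C (succ_vertex n v) = C (succ_vertex n v)"
    if no: "cycle_edge n v \<notin> M" "cycle_edge n (succ_vertex n v) \<notin> M"
  proof (rule route_unmatched, rule notI)
    assume "succ_vertex n v \<in> \<Union>M"
    then obtain i where i: "i \<in> {1..n}" "cycle_edge n i \<in> M" "succ_vertex n v \<in> cycle_edge n i"
      using M unfolding is_matching_def cycle_edges_def by auto
    then have "succ_vertex n v = i \<or> i = v"
      using succ_vertex_eqD[OF v i(1)] by (auto simp: cycle_edge_succ)
    then show False using i no by auto
  qed
qed

lemma succ_vertex_cong: "v \<in> {1..n} \<Longrightarrow> int n dvd int (succ_vertex n v) - int v - 1"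
  by (auto simp: succ_vertex_def)

text \<open>Let \<open>d v\<close> count the forward minus the backward steps of the token that
  starts at \<open>v\<close>. A token makes at most one step per round, and every swap moves one
  token forward and one backward, so the total is 0. The congruence records that the walk ends at
  the target.\<close>

lemma solution_displacement:
  assumes n: "n \<ge> 3"
  shows "is_solution (cycle_vertices n) (cycle_edges n) C Ms \<Longrightarrow>
    \<exists>d. (\<forall>v\<in>{1..n}. \<bar>d v\<bar> \<le> int (length Ms) \<and> int n dvd int (C v) - int v - d v) \<and> sum d {1..n} = 0"
proof (induction Ms arbitrary: C)
  case Nil
  then have "\<forall>v\<in>{1..n}. C v = v" by (simp add: is_solution_def cycle_vertices_def)
  then show ?case by (intro exI[of _ "\<lambda>_. 0"]) auto
next
  case (Cons M Ms)
  let ?\<sigma> = "succ_vertex n"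
  have M: "is_matching (cycle_edges n) M" using Cons.prems by (simp add: is_solution_def)
  have "is_solution (cycle_vertices n) (cycle_edges n) (route M C) Ms"
    using Cons.prems by (simp add: is_solution_def)
  from Cons.IH[OF this] obtain d where
    d: "\<And>v. v \<in> {1..n} \<Longrightarrow> \<bar>d v\<bar> \<le> int (length Ms)"
       "\<And>v. v \<in> {1..n} \<Longrightarrow> int n dvd int (route M C v) - int v - d v"
    and s: "sum d {1..n} = 0" by blast
  let ?g = "\<lambda>v. if cycle_edge n v \<in> M then d (?\<sigma> v) - d v + 1 else 0"
  text \<open>\<open>?g v\<close> is the effect of the edge from \<open>v\<close> to its successor; written like this, the changes
    telescope around the cycle.\<close>
  define e where "e w = (let v = (if w = 1 then n else w - 1) in d w + ?g w - ?g v)" for w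
  have e: "e (?\<sigma> v) = d (?\<sigma> v) + ?g (?\<sigma> v) - ?g v" if "v \<in> {1..n}" for v
  proof -
    have "(if ?\<sigma> v = 1 then n else ?\<sigma> v - 1) = v" using that by (auto simp: succ_vertex_def)
    then show ?thesis unfolding e_def Let_def by (simp only:)
  qed
  have ex: "\<exists>v\<in>{1..n}. w = ?\<sigma> v" if "w \<in> {1..n}" for w
    using bij_succ_vertex[of n] that unfolding bij_betw_def by blast
  have re: "sum (\<lambda>v. h (?\<sigma> v)) {1..n} = sum h {1..n}" for h :: "nat \<Rightarrow> int"
    using sum.reindex_bij_betw[OF bij_succ_vertex] .
  have "sum e {1..n} = (\<Sum>v=1..n. d (?\<sigma> v) + ?g (?\<sigma> v) - ?g v)"
    unfolding re[of e, symmetric] by (rule sum.cong[OF refl]) (rule e)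
  also have "\<dots> = 0" using re[of d] re[of ?g] s by (simp only: sum.distrib sum_subtractf)
  finally have "sum e {1..n} = 0" .
  moreover have "\<bar>e w\<bar> \<le> int (length (M # Ms)) \<and> int n dvd int (C w) - int w - e w"
    if w: "w \<in> {1..n}" for w
  proof -
    obtain v where v: "v \<in> {1..n}" and wv: "w = ?\<sigma> v" using ex[OF w] by blast
    \<comment> \<open>At most one of the two edges at \<open>w\<close> is matched. If it is the edge
      from \<open>v\<close>, the token first steps backward and its remaining walk is the one
      starting at \<open>v\<close>; if it is the edge to the successor, it first steps
      forward.\<close>
    consider (left) "cycle_edge n v \<in> M" "cycle_edge n w \<notin> M"
      | (right) "cycle_edge n v \<notin> M" "cycle_edge n w \<in> M"
      | (none) "cycle_edge n v \<notin> M" "cycle_edge n w \<notin> M"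
      using matching_cycle_succ[OF n M v] wv by blast
    then show ?thesis
    proof cases
      case left
      then have "e w = d v - 1" "route M C v = C w"
        using e[OF v] route_cycle(1)[OF n M v] unfolding wv by simp_all
      moreover have "int n dvd (int (route M C v) - int v - d v) - (int w - int v - 1)"
        using d(2)[OF v] succ_vertex_cong[OF v] unfolding wv by (rule dvd_diff)
      moreover have "(int (C w) - int v - d v) - (int w - int v - 1) = int (C w) - int w - (d v - 1)"
        by simp
      moreover have "\<bar>e w\<bar> \<le> 1 + int (length Ms)" using calculation(1) d(1)[OF v] by linarith
      ultimately show ?thesis by simp
    next
      case right
      then have "e w = d (?\<sigma> w) + 1" "route M C (?\<sigma> w) = C w"
        using e[OF v] route_cycle(2)[OF n M w] unfolding wv by simp_all
      moreover have "int n dvd (int (route M C (?\<sigma> w)) - int (?\<sigma> w) - d (?\<sigma> w)) + (int (?\<sigma> w) - int w - 1)"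
        using d(2)[OF succ_vertex_in[OF w]] succ_vertex_cong[OF w] by (rule dvd_add)
      moreover have "(int (C w) - int (?\<sigma> w) - d (?\<sigma> w)) + (int (?\<sigma> w) - int w - 1)
          = int (C w) - int w - (d (?\<sigma> w) + 1)"
        by simp
      moreover have "\<bar>e w\<bar> \<le> 1 + int (length Ms)"
        using calculation(1) d(1)[OF succ_vertex_in[OF w]] by linarith
      ultimately show ?thesis by simp
    next
      case none
      then have "e w = d w" "route M C w = C w"
        using e[OF v] route_cycle(3)[OF n M v] unfolding wv by simp_all
      then show ?thesis using d(1)[OF w] d(2)[OF w] by simp
    qed
  qed
  ultimately show ?case by blast
qed

section \<open>From sorting to routing\<close>

definition quasi_periodic :: "int \<Rightarrow> (int \<Rightarrow> int) \<Rightarrow> bool" where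
  "quasi_periodic n F \<longleftrightarrow> (\<forall>i. F (i + n) = F i + n)"

definition extend :: "nat \<Rightarrow> (nat \<Rightarrow> int) \<Rightarrow> int \<Rightarrow> int" where
  "extend n f i = f (nat (i mod int n)) + int n * (i div int n)"

lemma extend_of_nat [simp]: "p < n \<Longrightarrow> extend n f (int p) = f p"
  by (simp add: extend_def)

lemma quasi_periodic_extend: "n > 0 \<Longrightarrow> quasi_periodic (int n) (extend n f)"
  by (simp add: quasi_periodic_def extend_def distrib_left)

section \<open>What a round preserves: periodicity, injectivity and the sum over a period\<close>

lemma active_periodic: "active n t (i + n) = active n t i"
  by (metis (no_types, opaque_lifting) active_def add.assoc add.commute mod_add_self2)

lemma swapped_periodic:
  assumes "\<forall>i. A (i + n) = A i" "quasi_periodic n F"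
  shows "swapped A F (i + n) = swapped A F i"
proof -
  have "F (i + n + 1) = F (i + 1) + n" "F (i + n) = F i + n"
    using assms(2) unfolding quasi_periodic_def by (metis add.assoc add.commute)+
  then show ?thesis by (simp add: swapped_def assms(1))
qed

lemma quasi_periodic_compare_swap:
  assumes A: "\<forall>i. A (i + n) = A i" and F: "quasi_periodic n F"
  shows "quasi_periodic n (compare_swap A F)"
  unfolding quasi_periodic_def
proof
  fix i
  have "F (i + n + 1) = F (i + 1) + n" "F (i + n) = F i + n" "F (i + n - 1) = F (i - 1) + n"
    using F unfolding quasi_periodic_def by (metis add.assoc add.commute add_diff_eq diff_add_eq)+
  moreover have "swapped A F (i + n - 1) = swapped A F (i - 1)"
    using swapped_periodic[OF A F, of "i - 1"] by (simp add: algebra_simps)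
  ultimately show "compare_swap A F (i + n) = compare_swap A F i + n"
    using swapped_periodic[OF A F] by (simp add: compare_swap_def)
qed

lemma quasi_periodic_sweep: "quasi_periodic n F \<Longrightarrow> quasi_periodic n (sweep n F t)"
  by (induction t) (simp_all add: quasi_periodic_compare_swap active_periodic)

text \<open>A round composes \<open>F\<close> with an involution of the positions, because adjacent
  edges never swap together.\<close>

lemma inj_compare_swap:
  assumes A: "\<And>i. A i \<Longrightarrow> \<not> A (i - 1)" and F: "inj F"
  shows "inj (compare_swap A F)"
proof -
  define \<pi> where "\<pi> i = (if swapped A F i then i + 1 else if swapped A F (i - 1) then i - 1 else i)" for i
  have no: "swapped A F i \<Longrightarrow> \<not> swapped A F (i - 1)" for i
    using A by (auto simp: swapped_def)
  have no': "swapped A F i \<Longrightarrow> \<not> swapped A F (i + 1)" for i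
    using no[of "i + 1"] by auto
  have "\<pi> (\<pi> i) = i" for i
    using no[of i] no'[of i] no[of "i - 1"] by (auto simp: \<pi>_def)
  then have "inj \<pi>" by (metis injI)
  moreover have "compare_swap A F = F \<circ> \<pi>" by (auto simp: compare_swap_def \<pi>_def)
  ultimately show ?thesis using F by (simp add: inj_compose)
qed

lemma inj_sweep: "n > 0 \<Longrightarrow> inj F \<Longrightarrow> inj (sweep n F t)"
  by (induction t) (simp_all add: inj_compare_swap active_not_pred)

text \<open>What position \<open>i\<close> gains across edge \<open>i\<close> is lost by position
  \<open>i + 1\<close>, so the changes telescope; the contributions of the edges
  \<open>n - 1\<close> and \<open>- 1\<close> at the two ends of the period agree.\<close>

lemma sum_compare_swap:
  assumes no: "\<And>i. A i \<Longrightarrow> \<not> A (i - 1)" and A: "\<forall>i. A (i + int n) = A i"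
    and F: "quasi_periodic (int n) F"
  shows "(\<Sum>p<n. compare_swap A F (int p)) = (\<Sum>p<n. F (int p))"
proof -
  define g where "g i = (if swapped A F i then F (i + 1) - F i else 0)" for i
  have eq: "compare_swap A F i = F i + (g i - g (i - 1))" for i
    using no[of i] by (auto simp: compare_swap_def g_def swapped_def)
  have tel: "(\<Sum>p<m. g (int p) - g (int p - 1)) = g (int m - 1) - g (- 1)" for m
    by (induction m) simp_all
  have "F (int n - 1 + 1) = F (- 1 + 1) + int n" "F (int n - 1) = F (-1) + int n"
    using F[unfolded quasi_periodic_def, rule_format, of 0]
      F[unfolded quasi_periodic_def, rule_format, of "- 1"] by (simp_all add: algebra_simps)
  moreover have "swapped A F (int n - 1) = swapped A F (- 1)"
    using swapped_periodic[OF A F, of "- 1"] by (simp add: algebra_simps)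
  ultimately have "g (int n - 1) = g (- 1)" unfolding g_def by simp
  then show ?thesis unfolding eq sum.distrib using tel[of n] by simp
qed

lemma sum_sweep:
  assumes "n > 0" "quasi_periodic (int n) F"
  shows "(\<Sum>p<n. sweep (int n) F t (int p)) = (\<Sum>p<n. F (int p))"
  using assms by (induction t)
    (simp_all add: sum_compare_swap active_not_pred active_periodic quasi_periodic_sweep)

lemma quasi_periodic_add_mult:
  assumes "quasi_periodic n F"
  shows "F (i + n * m) = F i + n * m"
proof -
  have nat: "F (j + n * int k) = F j + n * int k" for j k
  proof (induction k)
    case (Suc k)
    have "F (j + n * int (Suc k)) = F ((j + n * int k) + n)" by (simp add: algebra_simps)
    also have "\<dots> = F (j + n * int k) + n" using assms by (simp add: quasi_periodic_def)
    finally show ?case using Suc by (simp add: algebra_simps)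
  qed simp
  show ?thesis
  proof (cases "m \<ge> 0")
    case True then show ?thesis using nat[of i "nat m"] by simp
  next
    case False then show ?thesis using nat[of "i + n * m" "nat (- m)"] by simp
  qed
qed

text \<open>Monotone and injective, \<open>F\<close> gains at least 1 in each step, but only
  \<open>n\<close> in \<open>n\<close> steps. So it is a translation, and the prescribed sum forces
  the translation by 0.\<close>

lemma thresholds_sorted_imp_identity:
  assumes n: "n > 0" and F: "quasi_periodic (int n) F" and inj: "inj F"
    and sum: "(\<Sum>p<n. F (int p)) = (\<Sum>p<n. int p)"
    and srt: "\<And>k. \<exists>c. \<forall>i. k \<le> F i \<longleftrightarrow> c \<le> i"
  shows "F i = i"
proof -
  have "F i < F (i + 1)" for i
  proof -
    obtain c where c: "\<forall>j. F i \<le> F j \<longleftrightarrow> c \<le> j" using srt by blast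
    then have "c \<le> i" by blast
    then have "F i \<le> F (i + 1)" using c by auto
    moreover have "F i \<noteq> F (i + 1)" using inj by (simp add: inj_eq)
    ultimately show ?thesis by simp
  qed
  note less = this
  have up: "F i + int m \<le> F (i + int m)" for i m
  proof (induction m)
    case (Suc m)
    have "F (i + int m) < F (i + int m + 1)" by (rule less)
    then show ?case using Suc by (simp add: algebra_simps)
  qed simp
  have base: "F (int p) = F 0 + int p" if "p < n" for p
  proof -
    have "F 0 + int p \<le> F (int p)" using up[of 0 p] by simp
    moreover have "F (int p) + int (n - p) \<le> F (0 + int n)"
      using up[of "int p" "n - p"] that by simp
    moreover have "F (0 + int n) = F 0 + int n" using F unfolding quasi_periodic_def by blast
    ultimately show ?thesis using that by simp
  qed
  have "(\<Sum>p<n. F (int p)) = (\<Sum>p<n. F 0 + int p)" using base by simp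
  then have "F 0 = 0" using sum n by (simp add: sum.distrib)
  then have b: "F (int p) = int p" if "p < n" for p using base[OF that] by simp
  have i: "i = int (nat (i mod int n)) + int n * (i div int n)" and "nat (i mod int n) < n"
    using n by (simp_all add: nat_less_iff)
  have "F i = F (int (nat (i mod int n))) + int n * (i div int n)"
    by (subst i) (rule quasi_periodic_add_mult[OF F])
  then show ?thesis using i b[OF \<open>nat (i mod int n) < n\<close>] by simp
qed

section \<open>Realising a round of swaps by a matching\<close>

definition tokens :: "nat \<Rightarrow> (int \<Rightarrow> int) \<Rightarrow> nat \<Rightarrow> nat" where
  "tokens n F v = nat (F (int v - 1) mod int n) + 1"

definition swap_matching :: "nat \<Rightarrow> (int \<Rightarrow> bool) \<Rightarrow> (int \<Rightarrow> int) \<Rightarrow> nat set set" where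
  "swap_matching n A F = {cycle_edge n v |v. v \<in> {1..n} \<and> swapped A F (int v - 1)}"

lemma inj_cycle_edge: "n \<ge> 3 \<Longrightarrow> inj_on (cycle_edge n) {1..n}"
  using succ_vertex_neq[of n] unfolding inj_on_def cycle_edge_succ by (metis doubleton_eq_iff)

lemma cycle_edge_swap_matching:
  "n \<ge> 3 \<Longrightarrow> v \<in> {1..n} \<Longrightarrow> cycle_edge n v \<in> swap_matching n A F \<longleftrightarrow> swapped A F (int v - 1)"
  using inj_cycle_edge[of n] unfolding swap_matching_def inj_on_def by blast

lemma compare_swap_routes:
  assumes n: "n \<ge> 3" and no: "\<And>i. A i \<Longrightarrow> \<not> A (i - 1)" and A: "\<forall>i. A (i + int n) = A i"
    and F: "quasi_periodic (int n) F" and C: "\<And>v. v \<in> {1..n} \<Longrightarrow> C v = tokens n F v"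
  shows "is_matching (cycle_edges n) (swap_matching n A F)"
    and "\<And>v. v \<in> {1..n} \<Longrightarrow> route (swap_matching n A F) C v = tokens n (compare_swap A F) v"
proof -
  let ?M = "swap_matching n A F" and ?\<sigma> = "succ_vertex n"
  \<comment> \<open>These four facts absorb the wrap from vertex \<open>n\<close> to vertex 1:
    positions \<open>n\<close> and 0 of the lift differ by one period, so passing to the successor
    acts as adding 1 to the position.\<close>
  have sw: "swapped A F (int (?\<sigma> u) - 1) = swapped A F (int u)" for u
    using swapped_periodic[OF A F, of 0] by (auto simp: succ_vertex_def)
  have sw': "swapped A F (int (?\<sigma> u) - 1 - 1) = swapped A F (int u - 1)" for u
    using swapped_periodic[OF A F, of "- 1"] by (auto simp: succ_vertex_def algebra_simps)
  have Fs: "F (int (?\<sigma> u) - 1) mod int n = F (int u) mod int n" for u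
    using F[unfolded quasi_periodic_def, rule_format, of 0] by (auto simp: succ_vertex_def)
  have Fs': "F (int (?\<sigma> u) - 1 - 1) mod int n = F (int u - 1) mod int n" for u
    using F[unfolded quasi_periodic_def, rule_format, of "- 1"]
    by (auto simp: succ_vertex_def algebra_simps)
  have excl: "swapped A F i \<Longrightarrow> \<not> swapped A F (i - 1)" for i
    using no by (auto simp: swapped_def)
  show M: "is_matching (cycle_edges n) ?M"
    unfolding is_matching_def
  proof
    show "?M \<subseteq> cycle_edges n" by (auto simp: swap_matching_def cycle_edges_def)
    show "pairwise disjnt ?M"
    proof (rule pairwiseI)
      fix e f assume e: "e \<in> ?M" and f: "f \<in> ?M" and ne: "e \<noteq> f"
      obtain i j where i: "i \<in> {1..n}" "e = cycle_edge n i" "swapped A F (int i - 1)"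
        and j: "j \<in> {1..n}" "f = cycle_edge n j" "swapped A F (int j - 1)"
        using e f unfolding swap_matching_def by blast
      have "i \<noteq> j" using ne i j by auto
      moreover have "i \<noteq> ?\<sigma> j" using i(3) j(3) excl[of "int i - 1"] sw'[of j] by auto
      moreover have "j \<noteq> ?\<sigma> i" using i(3) j(3) excl[of "int j - 1"] sw'[of i] by auto
      moreover have "?\<sigma> i \<noteq> ?\<sigma> j" using succ_vertex_eqD[OF i(1) j(1)] \<open>i \<noteq> j\<close> by blast
      ultimately show "disjnt e f" unfolding i(2) j(2) cycle_edge_succ by (simp add: disjnt_def)
    qed
  qed
  fix v assume v: "v \<in> {1..n}"
  obtain u where u: "u \<in> {1..n}" "v = ?\<sigma> u"
    using bij_succ_vertex[of n] v unfolding bij_betw_def by blast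
  have ev: "cycle_edge n v \<in> ?M \<longleftrightarrow> swapped A F (int v - 1)"
    using cycle_edge_swap_matching[OF n v] .
  have eu: "cycle_edge n u \<in> ?M \<longleftrightarrow> swapped A F (int v - 1 - 1)"
    using cycle_edge_swap_matching[OF n u(1)] sw'[of u] u(2) by simp
  show "route ?M C v = tokens n (compare_swap A F) v"
  proof (cases "swapped A F (int v - 1)")
    case True
    then have "route ?M C v = C (?\<sigma> v)" using route_cycle(1)[OF n M v] ev by simp
    then show ?thesis
      using True C[OF succ_vertex_in[OF v]] Fs[of v] by (simp add: tokens_def compare_swap_def)
  next
    case False
    show ?thesis
    proof (cases "swapped A F (int v - 1 - 1)")
      case True
      then have "route ?M C v = C u" using route_cycle(2)[OF n M u(1)] eu u(2) by simp
      then show ?thesis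
        using True False C[OF u(1)] Fs'[of u] u(2) by (simp add: tokens_def compare_swap_def)
    next
      case F: False
      then have "route ?M C v = C v"
        using route_cycle(3)[OF n M u(1)] eu ev u(2) False by simp
      then show ?thesis using False F C[OF v] by (simp add: tokens_def compare_swap_def)
    qed
  qed
qed

definition sweep_matchings :: "nat \<Rightarrow> (int \<Rightarrow> int) \<Rightarrow> nat \<Rightarrow> nat set set list" where
  "sweep_matchings n F T =
     map (\<lambda>t. swap_matching n (active (int n) t) (sweep (int n) F t)) [0..<T]"

lemma length_sweep_matchings [simp]: "length (sweep_matchings n F T) = T"
  by (simp add: sweep_matchings_def)

lemma sweep_matchings_routes:
  assumes n: "n \<ge> 3" and F: "quasi_periodic (int n) F"
    and C: "\<And>v. v \<in> {1..n} \<Longrightarrow> C v = tokens n F v"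
  shows "(\<forall>M\<in>set (sweep_matchings n F T). is_matching (cycle_edges n) M) \<and>
    (\<forall>v\<in>{1..n}. fold route (sweep_matchings n F T) C v = tokens n (sweep (int n) F T) v)"
proof (induction T)
  case 0
  then show ?case using C by (simp add: sweep_matchings_def)
next
  case (Suc T)
  have n0: "int n > 0" using n by simp
  have eq: "sweep_matchings n F (Suc T) = sweep_matchings n F T
      @ [swap_matching n (active (int n) T) (sweep (int n) F T)]"
    by (simp add: sweep_matchings_def)
  show ?case unfolding eq
    using Suc compare_swap_routes[of n "active (int n) T" "sweep (int n) F T"
        "fold route (sweep_matchings n F T) C"] n active_not_pred[OF n0] quasi_periodic_sweep[OF F]
    by (simp add: active_periodic)
qed

lemma sweep_matchings_solution:
  assumes n: "n \<ge> 3" and F: "quasi_periodic (int n) F"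
    and C: "\<And>v. v \<in> {1..n} \<Longrightarrow> C v = tokens n F v"
    and id: "\<And>i. sweep (int n) F T i = i"
  shows "is_solution (cycle_vertices n) (cycle_edges n) C (sweep_matchings n F T)"
proof -
  have "tokens n (sweep (int n) F T) v = v" if "v \<in> {1..n}" for v
    using that by (simp add: tokens_def id nat_diff_distrib)
  then show ?thesis using sweep_matchings_routes[OF n F C, where T = T]
    unfolding is_solution_def cycle_vertices_def by auto
qed

section \<open>Choice of the lift and number of rounds\<close>

text \<open>A crude bound, independent of the number \<open>p\<close> of ones, that provides some
  time at which everything is sorted. For odd \<open>n\<close> the \<open>div\<close> term costs at
  most 4 and the parity term at most 1, which \<open>3 * n\<close> rounds outweigh.\<close>

lemma height_eventually:
  fixes n :: int
  assumes n: "n \<ge> 3" and L: "int L \<le> n" and p: "0 \<le> p" "p \<le> int L"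
  shows "height n 0 (a - 1 + p) + int L - 1 \<le> height n (nat (3 * n)) (a - 1 + (int L - p))"
proof -
  let ?i = "a - 1 + (int L - p)" and ?j = "a - 1 + p"
  have "(?i + 3 * n) div n = ?i div n + 3" using n by simp
  moreover have "?i div n \<le> (?j + n) div n" using n L p by (intro zdiv_mono1) auto
  then have "?i div n \<le> ?j div n + 1" using n by simp
  ultimately have "(?i + 3 * n) div n \<le> ?j div n + 4" by simp
  moreover have "(?i + 3 * n) mod n mod 2 \<le> 1" "0 \<le> ?j mod n mod 2" by simp_all
  ultimately show ?thesis using n L unfolding height_def
    by (cases "even n") (simp_all add: mod2_eq_if)
qed

text \<open>The arguments of \<open>height\<close> in \<open>T\<close> are those of
  \<open>sweep_threshold_sorted\<close> with \<open>p = a k + L - k\<close>, the number of ones that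
  the identity has in the window. This makes the required number of rounds depend on the windows
  alone.\<close>

lemma window_sorted:
  assumes n: "n \<ge> 3" and F: "quasi_periodic (int n) F" "inj F"
    and sum: "(\<Sum>p<n. F (int p)) = (\<Sum>p<n. int p)" and L: "L \<le> n"
    and win: "\<And>k i. i < a k \<Longrightarrow> F i < k" "\<And>k i. i \<ge> a k + int L \<Longrightarrow> k \<le> F i"
    and T: "\<And>k. height (int n) 0 (2 * a k + int L - k - 1) + int L - 1 \<le> height (int n) T (k - 1)"
  shows "sweep (int n) F T i = i"
proof -
  have n0: "int n > 0" "n > 0" and n3: "int n \<ge> 3" using n by simp_all
  define p where "p k = ones k F (a k) L" for k
  have sorted: "k \<le> sweep (int n) F S i \<longleftrightarrow> a k + int L - p k \<le> i"
    if "height (int n) 0 (a k - 1 + p k) + int L - 1 \<le> height (int n) S (a k - 1 + (int L - p k))"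
    for k S i
    using sweep_threshold_sorted[OF n0(1) _ _ p_def that] win by blast
  have identity: "sweep (int n) F S i = i"
    if "\<And>k. height (int n) 0 (a k - 1 + p k) + int L - 1 \<le> height (int n) S (a k - 1 + (int L - p k))"
    for S i
  proof (rule thresholds_sorted_imp_identity[OF n0(2) quasi_periodic_sweep[OF F(1)] inj_sweep[OF n0(1) F(2)]])
    show "(\<Sum>p<n. sweep (int n) F S (int p)) = (\<Sum>p<n. int p)"
      using sum_sweep[OF n0(2) F(1), of S] sum by simp
    show "\<exists>c. \<forall>i. k \<le> sweep (int n) F S i \<longleftrightarrow> c \<le> i" for k
      using sorted[OF that, of k] by blast
  qed
  text \<open>The number of ones in a window never changes, so it can be read off a time at which
    everything is sorted.\<close>
  let ?S = "nat (3 * int n)"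
  have late: "height (int n) 0 (a k - 1 + p k) + int L - 1 \<le> height (int n) ?S (a k - 1 + (int L - p k))" for k
    using height_eventually[OF n3, of L "p k" "a k"] L ones_nonneg[of k F "a k" L]
      ones_le[of 0 L k F "a k"] by (simp add: p_def)
  have "k \<le> i \<longleftrightarrow> a k + int L - p k \<le> i" for k i
    using sorted[OF late, of k i] identity[OF late, of i] by simp
  then have "k = a k + int L - p k" for k by (metis order_antisym order_refl)
  then have p: "p k = a k + int L - k" for k by (metis diff_diff_eq2 add_diff_cancel_left')
  have "height (int n) 0 (a k - 1 + p k) + int L - 1 \<le> height (int n) T (a k - 1 + (int L - p k))" for k
    using T[of k] by (simp add: p algebra_simps)
  then show ?thesis by (rule identity)
qed

lemma mult_div_block:
  fixes n :: int
  assumes "n > 0"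
  shows "i < n * m \<Longrightarrow> n * (i div n) + n \<le> n * m" and "n * m \<le> i \<Longrightarrow> n * m \<le> n * (i div n)"
    and "n * (i div n) \<le> i" and "i < n * (i div n) + n"
proof -
  have i: "n * (i div n) + i mod n = i" "0 \<le> i mod n" "i mod n < n" using assms by simp_all
  then show le: "n * (i div n) \<le> i" and lt: "i < n * (i div n) + n" by linarith+
  show "n * (i div n) + n \<le> n * m" if "i < n * m"
  proof -
    have "n * (i div n) < n * m" using that le by linarith
    then have "n * (i div n + 1) \<le> n * m" using assms by simp
    then show ?thesis by (simp add: distrib_left)
  qed
  show "n * m \<le> n * (i div n)" if "n * m \<le> i"
  proof -
    have "n * m < n * (i div n + 1)" using that lt by (simp add: distrib_left)
    then show ?thesis using assms by simp
  qed
qed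

section \<open>The two candidate lifts and the number of rounds\<close>

definition plain :: "(nat \<Rightarrow> nat) \<Rightarrow> nat \<Rightarrow> int" where
  "plain C p = int (C (p + 1)) - 1"

text \<open>The displacement is reduced to the half-open interval from \<open>- n / 2\<close> to
  \<open>n / 2\<close>: a token exactly opposite its target is sent backward.\<close>

definition nearest :: "nat \<Rightarrow> (nat \<Rightarrow> nat) \<Rightarrow> nat \<Rightarrow> int" where
  "nearest n C p =
     (if int n \<le> 2 * (plain C p - int p) then plain C p - int n
      else if 2 * (plain C p - int p) < - int n then plain C p + int n
      else plain C p)"

definition deviation :: "nat \<Rightarrow> (nat \<Rightarrow> nat) \<Rightarrow> nat" where
  "deviation n C = Max ((\<lambda>p. nat \<bar>nearest n C p - int p\<bar>) ` {..<n})"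

definition balanced :: "nat \<Rightarrow> (nat \<Rightarrow> nat) \<Rightarrow> bool" where
  "balanced n C \<longleftrightarrow> (\<Sum>p<n. nearest n C p) = (\<Sum>p<n. int p)"

definition lifted :: "nat \<Rightarrow> (nat \<Rightarrow> nat) \<Rightarrow> nat \<Rightarrow> int" where
  "lifted n C = (if balanced n C then nearest n C else plain C)"

definition rounds :: "nat \<Rightarrow> (nat \<Rightarrow> nat) \<Rightarrow> nat" where
  "rounds n C = (if balanced n C then deviation n C + deviation n C else n) + n mod 2"

lemma configuration_range:
  "is_configuration (cycle_vertices n) C \<Longrightarrow> p < n \<Longrightarrow> 0 \<le> plain C p \<and> plain C p < int n"
  by (force simp: is_configuration_def cycle_vertices_def plain_def dest!: bij_betw_apply[of _ _ _ "p + 1"])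

lemma nearest_cong: "nearest n C p mod int n = plain C p mod int n"
  by (simp add: nearest_def)

lemma nearest_bounds:
  assumes "is_configuration (cycle_vertices n) C" "p < n"
  shows "- int n \<le> 2 * (nearest n C p - int p)" "2 * (nearest n C p - int p) < int n"
  using configuration_range[OF assms] assms(2) by (auto simp: nearest_def)

lemma lifted_cong:
  "is_configuration (cycle_vertices n) C \<Longrightarrow> p < n \<Longrightarrow> lifted n C p mod int n = plain C p"
  using configuration_range by (simp add: lifted_def nearest_cong)

lemma extend_mod: "n > 0 \<Longrightarrow> extend n f i mod int n = f (nat (i mod int n)) mod int n"
  by (simp add: extend_def)

lemma inj_extend_lifted:
  assumes C: "is_configuration (cycle_vertices n) C" and n: "n > 0"
  shows "inj (extend n (lifted n C))"
proof (rule injI)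
  fix i j assume e: "extend n (lifted n C) i = extend n (lifted n C) j"
  let ?p = "nat (i mod int n)" and ?q = "nat (j mod int n)"
  have lt: "?p < n" "?q < n" using n by (simp_all add: nat_less_iff)
  have "plain C ?p = plain C ?q"
    using arg_cong[OF e, of "\<lambda>x. x mod int n"] lifted_cong[OF C] lt n by (simp add: extend_mod)
  then have "C (?p + 1) = C (?q + 1)" by (simp add: plain_def)
  then have pq: "?p = ?q"
    using C lt unfolding is_configuration_def cycle_vertices_def bij_betw_def
    by (auto dest: inj_onD)
  then have "i div int n = j div int n" using e n by (simp add: extend_def)
  moreover have "i mod int n = j mod int n" using pq n by (simp add: eq_nat_nat_iff)
  ultimately show "i = j" by (metis mult_div_mod_eq)
qed

lemma sum_plain:
  assumes "is_configuration (cycle_vertices n) C"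
  shows "(\<Sum>p<n. plain C p) = (\<Sum>p<n. int p)"
proof -
  have sh: "(\<Sum>p<n. f (p + 1)) = sum f {1..n}" for f :: "nat \<Rightarrow> int"
    by (rule sum.reindex_bij_witness[where i = "\<lambda>v. v - 1" and j = "\<lambda>p. p + 1"]) auto
  have "(\<Sum>p<n. plain C p) = (\<Sum>v\<in>{1..n}. int (C v) - 1)"
    unfolding plain_def by (rule sh)
  also have "\<dots> = (\<Sum>v\<in>{1..n}. int v - 1)"
    using assms unfolding is_configuration_def cycle_vertices_def
    by (rule sum.reindex_bij_betw)
  also have "\<dots> = (\<Sum>p<n. int p)" unfolding sh[symmetric] by simp
  finally show ?thesis .
qed

lemma sum_lifted:
  assumes "is_configuration (cycle_vertices n) C"
  shows "(\<Sum>p<n. extend n (lifted n C) (int p)) = (\<Sum>p<n. int p)"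
  using sum_plain[OF assms] by (auto simp: lifted_def balanced_def)

lemma tokens_lifted:
  assumes "is_configuration (cycle_vertices n) C" "v \<in> {1..n}"
  shows "C v = tokens n (extend n (lifted n C)) v"
proof -
  have v: "int v - 1 = int (v - 1)" "v - 1 < n" "v - 1 + 1 = v" using assms(2) by auto
  have "C v \<ge> 1"
    using assms unfolding is_configuration_def cycle_vertices_def by (auto dest: bij_betw_apply)
  moreover have "lifted n C (v - 1) mod int n = int (C v) - 1"
    using lifted_cong[OF assms(1) v(2)] unfolding plain_def v(3) .
  ultimately show ?thesis unfolding tokens_def v(1) extend_of_nat[OF v(2)]
    by (simp add: nat_diff_distrib)
qed

lemma deviation_ge: "p < n \<Longrightarrow> \<bar>nearest n C p - int p\<bar> \<le> int (deviation n C)"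
  using Max_ge[of "(\<lambda>p. nat \<bar>nearest n C p - int p\<bar>) ` {..<n}" "nat \<bar>nearest n C p - int p\<bar>"]
  unfolding deviation_def by (simp add: nat_le_iff)

lemma deviation_le:
  assumes "n > 0" "\<And>p. p < n \<Longrightarrow> \<bar>nearest n C p - int p\<bar> \<le> int d"
  shows "deviation n C \<le> d"
  unfolding deviation_def using assms by (subst Max_le_iff) force+

lemma deviation_half:
  assumes "is_configuration (cycle_vertices n) C" "n > 0"
  shows "2 * deviation n C \<le> n"
proof -
  have "\<bar>nearest n C p - int p\<bar> \<le> int (n div 2)" if "p < n" for p
    using nearest_bounds[OF assms(1) that] by (simp add: zdiv_int)
  then have "deviation n C \<le> n div 2" using deviation_le[OF assms(2)] by blast
  then show ?thesis by simp
qed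

lemma rounds_le:
  assumes "is_configuration (cycle_vertices n) C" "n > 0"
  shows "rounds n C \<le> n + 1"
  using deviation_half[OF assms] by (auto simp: rounds_def)

lemma sweep_rounds_identity:
  assumes C: "is_configuration (cycle_vertices n) C" and n: "n \<ge> 3"
  shows "sweep (int n) (extend n (lifted n C)) (rounds n C) i = i"
proof -
  let ?F = "extend n (lifted n C)"
  have n0: "n > 0" using n by simp
  note F = n quasi_periodic_extend[OF n0] inj_extend_lifted[OF C n0] sum_lifted[OF C]
  have md: "i mod int n = int (nat (i mod int n))" "nat (i mod int n) < n" for i
    using n0 by (simp_all add: nat_less_iff)
  show ?thesis
  proof (cases "balanced n C")
    case True
    let ?D = "deviation n C"
    have dev: "\<bar>?F i - i\<bar> \<le> int ?D" for i
    proof -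
      have "i = i mod int n + int n * (i div int n)" by simp
      then have "?F i - i = nearest n C (nat (i mod int n)) - int (nat (i mod int n))"
        using True md(1)[of i] unfolding extend_def lifted_def by (simp only: if_True)
      then show ?thesis using deviation_ge[OF md(2)] by simp
    qed
    have half: "2 * ?D \<le> n" by (rule deviation_half[OF C n0])
    have T: "rounds n C = 2 * ?D + n mod 2" using True by (simp add: rounds_def)
    \<comment> \<open>A value moves by at most \<open>D\<close>, so only the positions from
      \<open>k - D\<close> up to but excluding \<open>k + D\<close> can be unsorted for
      \<open>k\<close>. This window is symmetric, and both surfaces are compared at the same
      position \<open>k - 1\<close>.\<close>
    show ?thesis
    proof (rule window_sorted[OF F, where a = "\<lambda>k. k - int ?D" and L = "2 * ?D"])
      show "2 * ?D \<le> n" by (rule half)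
      show "?F i < k" if "i < k - int ?D" for i k using dev[of i] that by linarith
      show "k \<le> ?F i" if "k - int ?D + int (2 * ?D) \<le> i" for i k using dev[of i] that by linarith
      fix k :: int
      have e: "2 * (k - int ?D) + int (2 * ?D) - k - 1 = k - 1" by simp
      have par: "x mod 2 \<le> 1" "0 \<le> x mod 2" for x :: int by simp_all
      show "height (int n) 0 (2 * (k - int ?D) + int (2 * ?D) - k - 1) + int (2 * ?D) - 1
          \<le> height (int n) (rounds n C) (k - 1)"
      proof (cases "even n")
        case True
        then have R: "rounds n C = 2 * ?D" "int n mod 2 = 0" using T by simp_all
        show ?thesis unfolding e R height_def
          using par[of "(k - 1) mod int n"] par[of "(k - 1 + int (2 * ?D)) mod int n"] by simp
      next
        case False
        then have R: "rounds n C = 2 * ?D + 1" "int n mod 2 = 1" using T by presburger+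
        \<comment> \<open>By parity there are at most \<open>n\<close> rounds, during which the
          \<open>div\<close> term grows by at most 1. The extra round pays for this.\<close>
        have "2 * ?D + 1 \<le> n" using half False by presburger
        then have "(k - 1 + int (2 * ?D + 1)) div int n \<le> (k - 1 + int n) div int n"
          using n0 by (intro zdiv_mono1) linarith+
        then have "(k - 1 + int (2 * ?D + 1)) div int n \<le> (k - 1) div int n + 1" using n0 by simp
        then show ?thesis unfolding e R height_def
          using par[of "(k - 1) mod int n"] par[of "(k - 1 + int (2 * ?D + 1)) mod int n"]
          by simp
      qed
    qed
  next
    case False
    have T: "rounds n C = n + n mod 2" using False by (simp add: rounds_def)
    have lo: "int n * (i div int n) \<le> ?F i" and hi: "?F i < int n * (i div int n) + int n" for i
      using configuration_range[OF C md(2)[of i]] False unfolding extend_def lifted_def by simp_all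
    \<comment> \<open>This lift maps each block of \<open>n\<close> positions to itself, so the
      block containing \<open>k\<close> serves as the window.\<close>
    show ?thesis
    proof (rule window_sorted[OF F, where a = "\<lambda>k. int n * (k div int n)" and L = n])
      show "n \<le> n" by simp
      have pos: "int n > 0" using n0 by simp
      show "?F i < k" if "i < int n * (k div int n)" for i k
        using mult_div_block(1)[OF pos that] mult_div_block(3)[OF pos, of k] hi[of i] by linarith
      show "k \<le> ?F i" if "int n * (k div int n) + int n \<le> i" for i k
        using mult_div_block(2)[OF pos, of "k div int n + 1" i] mult_div_block(4)[OF pos, of k] lo[of i] that
        by (simp add: distrib_left)
      fix k :: int
      define m where "m = k div int n"
      define r where "r = k mod int n"
      have k: "k = int n * m + r" and r: "0 \<le> r" "r < int n" using n0 by (simp_all add: m_def r_def)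
      have par: "x mod 2 \<le> 1" "0 \<le> x mod 2" for x :: int by simp_all
      show "height (int n) 0 (2 * (int n * (k div int n)) + int n - k - 1) + int n - 1
          \<le> height (int n) (rounds n C) (k - 1)"
      proof (cases "even n")
        case True
        then have R: "rounds n C = n" "int n mod 2 = 0" using T by simp_all
        show ?thesis unfolding R height_def
          using par[of "(2 * (int n * (k div int n)) + int n - k - 1) mod int n"]
            par[of "(k - 1 + int n) mod int n"] by simp
      next
        case False
        then have e: "int n mod 2 = 1" "n mod 2 = 1" by presburger+
        have i0: "2 * (int n * (k div int n)) + int n - k - 1 = (int n - r - 1) + int n * m"
          unfolding m_def[symmetric] using k by simp
        have d0: "((int n - r - 1) + int n * m) div int n = m" "((int n - r - 1) + int n * m) mod int n = int n - r - 1"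
          using r n0 by simp_all
        have i1: "k - 1 + int (n + 1) = r + int n * (m + 1)" using k by (simp add: algebra_simps)
        have d1: "(r + int n * (m + 1)) div int n = m + 1" "(r + int n * (m + 1)) mod int n = r"
          using r n0 by (simp_all del: distrib_left)
        \<comment> \<open>For odd \<open>n\<close> the parity terms of both surfaces agree, and the
          extra round pays for the growth of the \<open>div\<close> term by 1.\<close>
        have "(int n - r - 1) mod 2 = r mod 2" using False by presburger
        then show ?thesis unfolding T e(2) height_def i0 i1 d1 e(1)
          using d0 by simp
      qed
    qed
  qed
qed

text \<open>The displacement of a token in the solution equals its nearest one or differs from it by
  at least \<open>n\<close>; in the latter case it is at least \<open>n / 2\<close> and hence no
  shorter. If \<open>2 * length Ms < n\<close>, the latter case is impossible, so the nearest
  displacements inherit the sum 0 and \<open>C\<close> is balanced.\<close>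

lemma solution_lower_bound:
  assumes C: "is_configuration (cycle_vertices n) C" and n: "n \<ge> 3"
    and sol: "is_solution (cycle_vertices n) (cycle_edges n) C Ms"
  shows "rounds n C \<le> 2 * length Ms + n mod 2"
proof -
  obtain d where d: "\<And>v. v \<in> {1..n} \<Longrightarrow> \<bar>d v\<bar> \<le> int (length Ms)"
      "\<And>v. v \<in> {1..n} \<Longrightarrow> int n dvd int (C v) - int v - d v"
    and s: "sum d {1..n} = 0"
    using solution_displacement[OF n sol] by blast
  define g where "g p = nearest n C p - int p" for p
  have dv: "int n dvd g p - d (p + 1)" if "p < n" for p
  proof -
    have "int n dvd nearest n C p - plain C p" using nearest_cong by (simp add: mod_eq_dvd_iff)
    then have "int n dvd (nearest n C p - plain C p) + (int (C (p + 1)) - int (p + 1) - d (p + 1))"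
      using d(2)[of "p + 1"] that by (intro dvd_add) auto
    then show ?thesis by (simp add: g_def plain_def algebra_simps)
  qed
  have near: "g p = d (p + 1) \<or> int n \<le> \<bar>g p - d (p + 1)\<bar>" if "p < n" for p
    using dvd_imp_le_int[OF _ dv[OF that]] by auto
  have half: "- int n \<le> 2 * g p" "2 * g p < int n" if "p < n" for p
    using nearest_bounds[OF C that] by (simp_all add: g_def)
  have dl: "\<bar>d (p + 1)\<bar> \<le> int (length Ms)" if "p < n" for p using d(1)[of "p + 1"] that by auto
  show ?thesis
  proof (cases "balanced n C")
    case True
    have "\<bar>g p\<bar> \<le> int (length Ms)" if "p < n" for p
      using near[OF that] half[OF that] dl[OF that] by linarith
    then have "deviation n C \<le> length Ms"
      using n by (intro deviation_le) (auto simp: g_def)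
    then show ?thesis using True by (simp add: rounds_def)
  next
    case False
    have "n \<le> 2 * length Ms"
    proof (rule ccontr)
      assume "\<not> n \<le> 2 * length Ms"
      then have "g p = d (p + 1)" if "p < n" for p
        using near[OF that] half[OF that] dl[OF that] by linarith
      then have "(\<Sum>p<n. g p) = (\<Sum>p<n. d (p + 1))" by simp
      also have "\<dots> = sum d {1..n}"
        by (rule sum.reindex_bij_witness[where i = "\<lambda>v. v - 1" and j = "\<lambda>p. p + 1"]) auto
      finally have "(\<Sum>p<n. nearest n C p) = (\<Sum>p<n. int p)"
        using s by (simp add: g_def sum_subtractf)
      then show False using False by (simp add: balanced_def)
    qed
    then show ?thesis using False by (simp add: rounds_def)
  qed
qed

lemma rounds_solution:
  assumes C: "is_configuration (cycle_vertices n) C" and n: "n \<ge> 3"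
  defines "Ms \<equiv> sweep_matchings n (extend n (lifted n C)) (rounds n C)"
  shows "is_solution (cycle_vertices n) (cycle_edges n) C Ms"
    and "length Ms \<le> 2 * OPT (cycle_vertices n) (cycle_edges n) C + n mod 2"
proof -
  have n0: "n > 0" using n by simp
  show sol: "is_solution (cycle_vertices n) (cycle_edges n) C Ms" unfolding Ms_def
    by (rule sweep_matchings_solution[OF n quasi_periodic_extend[OF n0] tokens_lifted[OF C]
          sweep_rounds_identity[OF C n]])
  \<comment> \<open>The solution just built shows that the minimum defining \<open>OPT\<close> is
    attained.\<close>
  then have "\<exists>k Ms'. is_solution (cycle_vertices n) (cycle_edges n) C Ms' \<and> length Ms' = k" by blast
  from LeastI_ex[OF this] obtain Ms' where
    "is_solution (cycle_vertices n) (cycle_edges n) C Ms'"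
    "length Ms' = OPT (cycle_vertices n) (cycle_edges n) C"
    unfolding OPT_def by blast
  then show "length Ms \<le> 2 * OPT (cycle_vertices n) (cycle_edges n) C + n mod 2"
    using solution_lower_bound[OF C n] unfolding Ms_def by fastforce
qed

section \<open>The program\<close>

definition runs :: "com \<Rightarrow> memory \<Rightarrow> nat \<Rightarrow> (memory \<Rightarrow> bool) \<Rightarrow> bool" where
  "runs c s T Q \<longleftrightarrow> (\<exists>t s'. exec c s t s' \<and> t \<le> T \<and> Q s')"

primrec loop_free :: "com \<Rightarrow> bool" where
  "loop_free Skip \<longleftrightarrow> True"
| "loop_free (Assign x e) \<longleftrightarrow> True"
| "loop_free (Store a e f) \<longleftrightarrow> True"
| "loop_free (Seq c d) \<longleftrightarrow> loop_free c \<and> loop_free d"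
| "loop_free (Cond b c d) \<longleftrightarrow> loop_free c \<and> loop_free d"
| "loop_free (While b c) \<longleftrightarrow> False"

text \<open>Straight-line code can thus be evaluated by rewriting; the value for
  \<open>While\<close> is a dummy, excluded by \<open>loop_free\<close>.\<close>

primrec result :: "com \<Rightarrow> memory \<Rightarrow> memory" where
  "result Skip s = s"
| "result (Assign x e) s = set_reg x (aval e s) s"
| "result (Store a e f) s = set_cell a (aval e s) (aval f s) s"
| "result (Seq c d) s = result d (result c s)"
| "result (Cond b c d) s = (if bval b s then result c s else result d s)"
| "result (While b c) s = s"

primrec cost :: "com \<Rightarrow> nat" where
  "cost Skip = 1"
| "cost (Assign x e) = 1"
| "cost (Store a e f) = 1"
| "cost (Seq c d) = cost c + cost d"
| "cost (Cond b c d) = cost c + cost d + 1"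
| "cost (While b c) = 1"

lemma loop_free_exec: "loop_free c \<Longrightarrow> \<exists>t\<le>cost c. exec c s t (result c s)"
proof (induction c arbitrary: s)
  case (Seq c d)
  then obtain t u where "t \<le> cost c" "exec c s t (result c s)"
    "u \<le> cost d" "exec d (result c s) u (result d (result c s))" by fastforce
  then show ?case by (intro exI[of _ "t + u"]) (auto intro: exec_Seq)
next
  case (Cond b c d)
  show ?case
  proof (cases "bval b s")
    case True
    obtain t where "t \<le> cost c" "exec c s t (result c s)" using Cond by fastforce
    then show ?thesis using True by (intro exI[of _ "t + 1"]) (auto intro: exec_CondT[simplified])
  next
    case False
    obtain t where "t \<le> cost d" "exec d s t (result d s)" using Cond by fastforce
    then show ?thesis using False by (intro exI[of _ "t + 1"]) (auto intro: exec_CondF[simplified])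
  qed
qed (auto intro: exec.intros exec_Skip[simplified] exec_Assign[simplified] exec_Store[simplified])

lemma runs_loop_free: "loop_free c \<Longrightarrow> Q (result c s) \<Longrightarrow> runs c s (cost c) Q"
  using loop_free_exec[of c s] unfolding runs_def by blast

lemma runs_Seq:
  assumes "runs c s T P" "\<And>s'. P s' \<Longrightarrow> runs d s' U Q"
  shows "runs (Seq c d) s (T + U) Q"
  using assms unfolding runs_def by (meson add_mono exec_Seq)

lemma runs_Cond:
  assumes "bval b s \<Longrightarrow> runs c s T Q" "\<not> bval b s \<Longrightarrow> runs d s T Q"
  shows "runs (Cond b c d) s (T + 1) Q"
  using assms unfolding runs_def by (cases "bval b s") (meson add_le_mono1 exec_CondT exec_CondF)+

lemma runs_mono: "runs c s T Q \<Longrightarrow> T \<le> U \<Longrightarrow> (\<And>s'. Q s' \<Longrightarrow> R s') \<Longrightarrow> runs c s U R"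
  unfolding runs_def by (meson le_trans)

lemma runs_While:
  assumes "I 0 s"
    and step: "\<And>k s. k < N \<Longrightarrow> I k s \<Longrightarrow> bval b s \<and> runs c s T (I (Suc k))"
    and exit: "\<And>s. I N s \<Longrightarrow> \<not> bval b s"
  shows "runs (While b c) s (N * (T + 1) + 1) (I N)"
proof -
  have "runs (While b c) s ((N - k) * (T + 1) + 1) (I N)" if "k \<le> N" "I k s" for k s
    using that
  proof (induction "N - k" arbitrary: k s)
    case 0
    then have "k = N" by simp
    then have "exec (While b c) s 1 s" "I N s" using exec_WhileF[OF exit] 0 by auto
    then show ?case using 0 unfolding runs_def by auto
  next
    case (Suc m)
    then have k: "k < N" by simp
    obtain t s' where t: "bval b s" "exec c s t s'" "t \<le> T" "I (Suc k) s'"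
      using step[OF k Suc.prems(2)] unfolding runs_def by blast
    have "runs (While b c) s' ((N - Suc k) * (T + 1) + 1) (I N)"
      using Suc.hyps k t by (intro Suc.hyps(1)) auto
    then obtain u s'' where u: "exec (While b c) s' u s''" "u \<le> (N - Suc k) * (T + 1) + 1" "I N s''"
      unfolding runs_def by blast
    have "exec (While b c) s (t + u + 1) s''" by (rule exec_WhileT[OF t(1,2) u(1)])
    moreover have "t + u + 1 \<le> (N - k) * (T + 1) + 1"
      using t(3) u(2) k by (simp add: Suc_diff_Suc[symmetric] del: Suc_diff_Suc)
    ultimately show ?case using u(3) unfolding runs_def by blast
  qed
  from this[of 0 s] show ?thesis using assms(1) by simp
qed

lemmas memory_simps = set_reg_def set_cell_def

section \<open>The code of the algorithm\<close>

definition seqs :: "com list \<Rightarrow> com" where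
  "seqs cs = foldr Seq cs Skip"

lemma seqs_simps [simp]: "seqs [] = Skip" "seqs (c # cs) = Seq c (seqs cs)"
  by (simp_all add: seqs_def)

definition incr :: "name \<Rightarrow> com" where
  "incr x = Assign x (Add (Reg x) (Const 1))"

text \<open>Cell \<open>p\<close> of the array \<open>x\<close> holds \<open>F p + n\<close>, which is never negative.  In round \<open>t\<close> at edge
  \<open>j\<close>, register \<open>r\<close> holds \<open>(t + j) mod n\<close> and \<open>b\<close> its parity, so \<open>b\<close> tells whether the edge is active.\<close>

definition measure_body :: com where
  "measure_body = seqs [
     Cond (Less (Add (Cell ''in'' (Reg ''i'')) (Cell ''in'' (Reg ''i'')))
             (Add (Add (Reg ''i'') (Reg ''i'')) (Add (Const 2) (Reg ''inlen''))))
       (Cond (Less (Add (Add (Cell ''in'' (Reg ''i'')) (Cell ''in'' (Reg ''i''))) (Reg ''inlen''))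
               (Add (Add (Reg ''i'') (Reg ''i'')) (Const 2)))
         (Store ''x'' (Reg ''i'') (Monus (Add (Cell ''in'' (Reg ''i'')) (Add (Reg ''inlen'') (Reg ''inlen''))) (Const 1)))
         (Store ''x'' (Reg ''i'') (Monus (Add (Cell ''in'' (Reg ''i'')) (Reg ''inlen'')) (Const 1))))
       (Store ''x'' (Reg ''i'') (Monus (Cell ''in'' (Reg ''i'')) (Const 1))),
     Assign ''z'' (Add (Reg ''i'') (Reg ''inlen'')),
     Assign ''d'' (Add (Monus (Cell ''x'' (Reg ''i'')) (Reg ''z'')) (Monus (Reg ''z'') (Cell ''x'' (Reg ''i'')))),
     Cond (Less (Reg ''dev'') (Reg ''d'')) (Assign ''dev'' (Reg ''d'')) Skip,
     Assign ''sumx'' (Add (Reg ''sumx'') (Cell ''x'' (Reg ''i''))),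
     Assign ''sumz'' (Add (Reg ''sumz'') (Reg ''z'')),
     incr ''i'']"

definition copy_body :: com where
  "copy_body = Seq
     (Store ''x'' (Reg ''i'') (Monus (Add (Cell ''in'' (Reg ''i'')) (Reg ''inlen'')) (Const 1)))
     (incr ''i'')"

text \<open>At the wrap \<open>b\<close> is reset instead of flipped, because for odd
  \<open>n\<close> the residues \<open>n - 1\<close> and 0 are both even.\<close>

definition advance :: com where
  "advance = Seq (incr ''r'')
     (Cond (Equal (Reg ''r'') (Reg ''inlen''))
       (Seq (Assign ''r'' (Const 0)) (Assign ''b'' (Const 0)))
       (Assign ''b'' (Monus (Const 1) (Reg ''b''))))"

text \<open>The offset \<open>o\<close> is \<open>n\<close> just at the edge closing the cycle,
  where cell \<open>w = 0\<close> stands for position \<open>n\<close>. As \<open>out\<close> is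
  initially 0, a bit is written only when a swap takes place.\<close>

definition edge_body :: com where
  "edge_body = seqs [
     Assign ''w'' (Add (Reg ''j'') (Const 1)),
     Assign ''o'' (Const 0),
     Cond (Equal (Reg ''w'') (Reg ''inlen''))
       (Seq (Assign ''w'' (Const 0)) (Assign ''o'' (Reg ''inlen''))) Skip,
     Cond (Conj (Equal (Reg ''b'') (Const 1))
            (Less (Add (Cell ''x'' (Reg ''w'')) (Reg ''o'')) (Cell ''x'' (Reg ''j''))))
       (seqs [
          Store ''out'' (Reg ''outlen'') (Const 1),
          Assign ''tmp'' (Monus (Cell ''x'' (Reg ''j'')) (Reg ''o'')),
          Store ''x'' (Reg ''j'') (Add (Cell ''x'' (Reg ''w'')) (Reg ''o'')),
          Store ''x'' (Reg ''w'') (Reg ''tmp'')])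
       Skip,
     incr ''outlen'', incr ''j'', advance]"

text \<open>After \<open>n\<close> edges \<open>r\<close> and \<open>b\<close> are back at their
  values from the start of the round; the additional \<open>advance\<close> reflects the increase of
  \<open>t\<close>.\<close>

definition round_body :: com where
  "round_body = Seq (Assign ''j'' (Const 0))
     (Seq (While (Less (Reg ''j'') (Reg ''inlen'')) edge_body) (Seq advance (incr ''t'')))"

text \<open>Both sums carry the same total shift \<open>n * n\<close>, so their comparison tests
  \<open>balanced\<close>. If it fails, \<open>x\<close> is overwritten by the plain lift.\<close>

definition set_rounds :: "nat \<Rightarrow> com" where
  "set_rounds e = Cond (Equal (Reg ''sumx'') (Reg ''sumz''))
     (Assign ''rounds'' (Add (Add (Reg ''dev'') (Reg ''dev'')) (Const e)))
     (Seq (Assign ''i'' (Const 0))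
        (Seq (While (Less (Reg ''i'') (Reg ''inlen'')) copy_body)
           (Assign ''rounds'' (Add (Reg ''inlen'') (Const e)))))"

text \<open>The parameter is the parity of the cycle length.\<close>

definition cycle_routing :: "nat \<Rightarrow> com" where
  "cycle_routing e = Seq (While (Less (Reg ''i'') (Reg ''inlen'')) measure_body)
     (Seq (set_rounds e) (While (Less (Reg ''t'') (Reg ''rounds'')) round_body))"

section \<open>Effect of the code on a single edge\<close>

lemma advance_result:
  assumes "n \<ge> 3" "reg s ''inlen'' = n" "reg s ''r'' = q mod n" "reg s ''b'' = q mod n mod 2"
  shows "result advance s = s\<lparr>reg := (reg s)(''r'' := Suc q mod n, ''b'' := Suc q mod n mod 2)\<rparr>"
proof (cases "Suc (q mod n) = n")
  case True
  then show ?thesis using assms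
    by (simp add: advance_def incr_def memory_simps mod_Suc fun_upd_twist)
next
  case False
  have "1 - m mod 2 = Suc m mod 2" for m :: nat by presburger
  then show ?thesis using False assms
    by (simp add: advance_def incr_def memory_simps mod_Suc)
qed

lemma edge_body_result:
  fixes s :: memory
  assumes "n \<ge> 3" "reg s ''inlen'' = n" "reg s ''r'' = q mod n" "reg s ''b'' = q mod n mod 2"
  defines "j \<equiv> reg s ''j''"
  defines "w \<equiv> (if j + 1 = n then 0 else j + 1)" and "off \<equiv> (if j + 1 = n then n else 0)"
    and "x \<equiv> arr s ''x''"
  defines "swap \<equiv> odd (q mod n) \<and> x w + off < x j"
  shows "arr (result edge_body s) ''x'' = (if swap then x(j := x w + off, w := x j - off) else x)"
    and "arr (result edge_body s) ''out'' =
      (if swap then (arr s ''out'')(reg s ''outlen'' := 1) else arr s ''out'')"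
    and "reg (result edge_body s) ''outlen'' = Suc (reg s ''outlen'')"
    and "reg (result edge_body s) ''j'' = Suc j"
    and "reg (result edge_body s) ''r'' = Suc q mod n"
    and "reg (result edge_body s) ''b'' = Suc q mod n mod 2"
    and "reg (result edge_body s) ''inlen'' = n"
    and "reg (result edge_body s) ''t'' = reg s ''t''"
    and "reg (result edge_body s) ''rounds'' = reg s ''rounds''"
proof -
  \<comment> \<open>The memory after locating the far end of the edge (\<open>s1\<close>), after the
    possible swap (\<open>s2\<close>) and after updating the counters (\<open>s3\<close>).\<close>
  define s1 where "s1 = s\<lparr>reg := (reg s)(''w'' := w, ''o'' := off)\<rparr>"
  define s2 where "s2 = (if swap then s1\<lparr>reg := (reg s1)(''tmp'' := x j - off),
      arr := (arr s)(''x'' := x(j := x w + off, w := x j - off), ''out'' := (arr s ''out'')(reg s ''outlen'' := 1))\<rparr> else s1)"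
  define s3 where "s3 = s2\<lparr>reg := (reg s2)(''outlen'' := Suc (reg s ''outlen''), ''j'' := Suc j)\<rparr>"
  have odd: "odd (q mod n) \<longleftrightarrow> reg s ''b'' = 1" using assms(4) by (simp add: odd_iff_mod_2_eq_one)
  have s1: "result (Cond (Equal (Reg ''w'') (Reg ''inlen''))
       (Seq (Assign ''w'' (Const 0)) (Assign ''o'' (Reg ''inlen''))) Skip)
     (result (Assign ''o'' (Const 0)) (result (Assign ''w'' (Add (Reg ''j'') (Const 1))) s)) = s1"
    using assms(2) by (simp add: s1_def memory_simps j_def w_def off_def fun_upd_twist)
  have s2: "result (Cond (Conj (Equal (Reg ''b'') (Const 1))
            (Less (Add (Cell ''x'' (Reg ''w'')) (Reg ''o'')) (Cell ''x'' (Reg ''j''))))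
       (seqs [
          Store ''out'' (Reg ''outlen'') (Const 1),
          Assign ''tmp'' (Monus (Cell ''x'' (Reg ''j'')) (Reg ''o'')),
          Store ''x'' (Reg ''j'') (Add (Cell ''x'' (Reg ''w'')) (Reg ''o'')),
          Store ''x'' (Reg ''w'') (Reg ''tmp'')])
       Skip) s1 = s2"
    unfolding s2_def swap_def odd
    by (simp add: s1_def memory_simps x_def j_def[symmetric] fun_upd_twist)
  have s3: "result (incr ''j'') (result (incr ''outlen'') s2) = s3"
    by (simp add: s3_def s2_def s1_def incr_def memory_simps j_def fun_upd_twist)
  have "result edge_body s = result advance s3"
    unfolding edge_body_def using s1 s2 s3 by simp
  also have "\<dots> = s3\<lparr>reg := (reg s3)(''r'' := Suc q mod n, ''b'' := Suc q mod n mod 2)\<rparr>"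
    using assms by (intro advance_result) (auto simp: s3_def s2_def s1_def)
  finally have res: "result edge_body s = \<dots>" .
  show "arr (result edge_body s) ''x'' = (if swap then x(j := x w + off, w := x j - off) else x)"
    "arr (result edge_body s) ''out'' =
      (if swap then (arr s ''out'')(reg s ''outlen'' := 1) else arr s ''out'')"
    "reg (result edge_body s) ''outlen'' = Suc (reg s ''outlen'')"
    "reg (result edge_body s) ''j'' = Suc j"
    "reg (result edge_body s) ''r'' = Suc q mod n"
    "reg (result edge_body s) ''b'' = Suc q mod n mod 2"
    "reg (result edge_body s) ''inlen'' = n"
    "reg (result edge_body s) ''t'' = reg s ''t''"
    "reg (result edge_body s) ''rounds'' = reg s ''rounds''"
    unfolding res using assms(2) by (simp_all add: s3_def s2_def s1_def x_def)
qed

text \<open>Describes an unfinished round, in which the edges before \<open>j\<close> have been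
  processed in place. Reducing \<open>i\<close> modulo \<open>n\<close> keeps it periodic.\<close>

definition active_below :: "int \<Rightarrow> nat \<Rightarrow> nat \<Rightarrow> int \<Rightarrow> bool" where
  "active_below n t j i \<longleftrightarrow> active n t i \<and> i mod n < int j"

lemma compare_swap_cong:
  "swapped A F i = swapped B F i \<Longrightarrow> swapped A F (i - 1) = swapped B F (i - 1) \<Longrightarrow>
   compare_swap A F i = compare_swap B F i"
  by (simp add: compare_swap_def)

lemma compare_swap_idle:
  "\<not> swapped A F i \<Longrightarrow> \<not> swapped A F (i - 1) \<Longrightarrow> compare_swap A F i = F i"
  by (simp add: compare_swap_def)

lemma active_mod: "active n t (i mod n) = active n t i"
  by (simp add: active_def mod_add_left_eq)

text \<open>Processing the edges one after another in place agrees with a simultaneous round: if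
  edge \<open>j\<close> is active, its two neighbouring edges are not, so both of its ends still
  hold their values from the start of the round.\<close>

lemma compare_swap_next_edge:
  fixes x :: "nat \<Rightarrow> nat"
  assumes n: "n \<ge> 3" and j: "j < n" and F: "quasi_periodic (int n) F"
    and x: "\<And>p. p < n \<Longrightarrow> int (x p) = compare_swap (active_below (int n) t j) F (int p) + int n"
  defines "w \<equiv> (if j + 1 = n then 0 else j + 1)" and "off \<equiv> (if j + 1 = n then n else 0)"
  defines "swap \<equiv> active (int n) t (int j) \<and> x w + off < x j"
  shows "swap \<longleftrightarrow> swapped (active (int n) t) F (int j)"
    and "\<And>p. p < n \<Longrightarrow> int ((if swap then x(j := x w + off, w := x j - off) else x) p) =
      compare_swap (active_below (int n) t (Suc j)) F (int p) + int n"
proof -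
  let ?A = "active (int n) t" and ?B = "active_below (int n) t j" and ?B' = "active_below (int n) t (Suc j)"
  have n0: "int n > 0" using n by simp
  have other: "swapped ?B' F i = swapped ?B F i" if "i mod int n \<noteq> int j" for i
    using that by (auto simp: swapped_def active_below_def)
  have jm: "int j mod int n = int j" using j by simp
  have w: "w < n" "w \<noteq> j" using j n by (auto simp: w_def)
  have wm: "(int w - 1) mod int n = int j"
  proof (cases "j + 1 = n")
    case True
    have "(- 1) mod int n = int n - 1" using n by (simp add: zmod_minus1)
    then show ?thesis using True by (auto simp: w_def)
  qed (use j in \<open>simp add: w_def\<close>)
  have pred: "(int p - 1) mod int n = int j \<longleftrightarrow> p = w" if "p < n" for p
  proof
    assume "(int p - 1) mod int n = int j"
    then have "int p mod int n = int w mod int n"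
      using wm by (metis diff_add_cancel mod_add_left_eq)
    then show "p = w" using that w by simp
  qed (use wm in simp)
  have wo: "F (int w) + int off = F (int j + 1)" "F (int w - 1) + int off = F (int j)"
  proof -
    have "F (int n) = F 0 + int n" "F (int n - 1) = F (- 1) + int n"
      using F[unfolded quasi_periodic_def, rule_format, of 0]
        F[unfolded quasi_periodic_def, rule_format, of "- 1"] by (simp_all add: add.commute)
    moreover have "int n = int j + 1" if "j + 1 = n" using that by simp
    ultimately show "F (int w) + int off = F (int j + 1)" "F (int w - 1) + int off = F (int j)"
      by (cases "j + 1 = n"; simp add: w_def off_def add.commute)+
  qed
  have key: "(swap \<longleftrightarrow> swapped ?A F (int j)) \<and> (?A (int j) \<longrightarrow>
     int (x j) = F (int j) + int n \<and> int (x w) = F (int w) + int n)"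
  proof (cases "?A (int j)")
    case True
    have "\<not> ?A (int j - 1)" by (rule active_not_pred[OF n0 True])
    moreover have "\<not> ?A (int w)"
    proof
      assume "?A (int w)"
      then have "\<not> ?A ((int w - 1) mod int n)" unfolding active_mod by (rule active_not_pred[OF n0])
      then show False using wm True by simp
    qed
    ultimately have "compare_swap ?B F (int j) = F (int j)" "compare_swap ?B F (int w) = F (int w)"
      by (intro compare_swap_idle; simp add: swapped_def active_below_def jm wm)+
    then have "int (x j) = F (int j) + int n" "int (x w) = F (int w) + int n"
      using x j w by simp_all
    moreover from this have "x w + off < x j \<longleftrightarrow> F (int j + 1) < F (int j)"
      using wo by linarith
    ultimately show ?thesis using True by (simp add: swap_def swapped_def)
  qed (simp add: swap_def swapped_def)
  then show "swap \<longleftrightarrow> swapped ?A F (int j)" by blast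
  fix p assume p: "p < n"
  have pm: "int p mod int n = int p" using p by simp
  show "int ((if swap then x(j := x w + off, w := x j - off) else x) p) = compare_swap ?B' F (int p) + int n"
  proof (cases swap)
    case False
    \<comment> \<open>By periodicity, a failed test at \<open>j\<close> rules out a swap at every
      translate of edge \<open>j\<close>, so enlarging the processed set changes nothing.\<close>
    then have "\<not> swapped ?A F i" if "i mod int n = int j" for i
    proof -
      have i: "int j + int n * (i div int n) = i" using mult_div_mod_eq[of "int n" i] that by simp
      then have i1: "(int j + 1) + int n * (i div int n) = i + 1" by simp
      have "F i = F (int j) + int n * (i div int n)"
        using quasi_periodic_add_mult[OF F, of "int j" "i div int n"] unfolding i .
      moreover have "F (i + 1) = F (int j + 1) + int n * (i div int n)"
        using quasi_periodic_add_mult[OF F, of "int j + 1" "i div int n"] unfolding i1 .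
      moreover have "?A i = ?A (int j)" using active_mod[of "int n" t i] that by simp
      ultimately show ?thesis using key False by (simp add: swapped_def)
    qed
    then have "swapped ?B' F i = swapped ?B F i" for i
      using other[of i] by (cases "i mod int n = int j") (auto simp: swapped_def active_below_def)
    then have "compare_swap ?B' F (int p) = compare_swap ?B F (int p)"
      by (intro compare_swap_cong) simp_all
    then show ?thesis using False x[OF p] by simp
  next
    case True
    then have act: "?A (int j)" and sw: "swapped ?A F (int j)" and lt: "x w + off < x j"
      using key by (auto simp: swap_def)
    have xj: "int (x j) = F (int j) + int n" and xw: "int (x w) = F (int w) + int n"
      using key act by blast+
    consider "p = w" | "p = j" | "p \<noteq> w" "p \<noteq> j" by blast
    then show ?thesis
    proof cases
      case 1
      have "?A (int w - 1)" using act wm active_mod by metis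
      moreover have "F (int w) < F (int w - 1)" using sw wo by (simp add: swapped_def)
      ultimately have "swapped ?B' F (int w - 1)" by (simp add: swapped_def active_below_def wm)
      moreover have "\<not> swapped ?B' F (int w)"
        using active_not_pred[OF n0, of t "int w"] \<open>?A (int w - 1)\<close>
        by (auto simp: swapped_def active_below_def)
      ultimately have "compare_swap ?B' F (int p) = F (int w - 1)" using 1 by (simp add: compare_swap_def)
      moreover have "int (x j - off) = int (x j) - int off" using lt by simp
      ultimately show ?thesis using True 1 xj wo by simp
    next
      case 2
      have "swapped ?B' F (int j)" using sw by (simp add: swapped_def active_below_def jm)
      then have "compare_swap ?B' F (int p) = F (int j + 1)" using 2 by (simp add: compare_swap_def)
      then show ?thesis using True 2 w xw wo by simp
    next
      case 3
      have "compare_swap ?B' F (int p) = compare_swap ?B F (int p)"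
        using 3 pm pred[OF p] by (intro compare_swap_cong other) auto
      then show ?thesis using 3 x[OF p] by simp
    qed
  qed
qed

section \<open>Invariants of the sorting loops\<close>

definition edge_bit :: "nat \<Rightarrow> (int \<Rightarrow> int) \<Rightarrow> nat \<Rightarrow> nat" where
  "edge_bit n F m =
     (if swapped (active (int n) (m div n)) (sweep (int n) F (m div n)) (int (m mod n)) then 1 else 0)"

definition represents :: "nat \<Rightarrow> (nat \<Rightarrow> nat) \<Rightarrow> (int \<Rightarrow> int) \<Rightarrow> bool" where
  "represents n x F \<longleftrightarrow> (\<forall>p<n. int (x p) = F (int p) + int n)"

definition edge_inv :: "nat \<Rightarrow> (int \<Rightarrow> int) \<Rightarrow> nat \<Rightarrow> nat \<Rightarrow> nat \<Rightarrow> memory \<Rightarrow> bool" where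
  "edge_inv n F R t j s \<longleftrightarrow>
     reg s ''inlen'' = n \<and> reg s ''j'' = j \<and> reg s ''t'' = t \<and> reg s ''rounds'' = R \<and>
     reg s ''r'' = (t + j) mod n \<and> reg s ''b'' = (t + j) mod n mod 2 \<and> reg s ''outlen'' = t * n + j \<and>
     represents n (arr s ''x'') (compare_swap (active_below (int n) t j) (sweep (int n) F t)) \<and>
     (\<forall>m. arr s ''out'' m = (if m < t * n + j then edge_bit n F m else 0))"

definition round_inv :: "nat \<Rightarrow> (int \<Rightarrow> int) \<Rightarrow> nat \<Rightarrow> nat \<Rightarrow> memory \<Rightarrow> bool" where
  "round_inv n F R t s \<longleftrightarrow>
     reg s ''inlen'' = n \<and> reg s ''t'' = t \<and> reg s ''rounds'' = R \<and>
     reg s ''r'' = t mod n \<and> reg s ''b'' = t mod n mod 2 \<and> reg s ''outlen'' = t * n \<and>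
     represents n (arr s ''x'') (sweep (int n) F t) \<and>
     (\<forall>m. arr s ''out'' m = (if m < t * n then edge_bit n F m else 0))"

lemma loop_free_bodies:
  "loop_free edge_body" "loop_free measure_body" "loop_free copy_body" "loop_free (Seq advance (incr x))"
  by (simp_all add: edge_body_def measure_body_def copy_body_def advance_def incr_def)

lemma cost_bodies:
  "cost edge_body \<le> 30" "cost measure_body \<le> 25" "cost copy_body \<le> 2" "cost (Seq advance (incr x)) \<le> 8"
  by (simp_all add: edge_body_def measure_body_def copy_body_def advance_def incr_def)

lemma edge_inv_step:
  assumes n: "n \<ge> 3" and F: "quasi_periodic (int n) F" and j: "j < n" and inv: "edge_inv n F R t j s"
  shows "edge_inv n F R t (Suc j) (result edge_body s)"
proof -
  let ?G = "sweep (int n) F t" and ?x = "arr s ''x''"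
  have i: "reg s ''inlen'' = n" "reg s ''r'' = (t + j) mod n" "reg s ''b'' = (t + j) mod n mod 2"
    and regs: "reg s ''j'' = j" "reg s ''t'' = t" "reg s ''rounds'' = R" "reg s ''outlen'' = t * n + j"
    and x: "\<And>p. p < n \<Longrightarrow> int (?x p) = compare_swap (active_below (int n) t j) ?G (int p) + int n"
    and out: "\<And>m. arr s ''out'' m = (if m < t * n + j then edge_bit n F m else 0)"
    using inv by (auto simp: edge_inv_def represents_def)
  note res = edge_body_result[OF n i, unfolded regs]
  have act: "active (int n) t (int j) \<longleftrightarrow> odd ((t + j) mod n)"
    unfolding active_def by (metis add.commute even_of_nat of_nat_add of_nat_mod)
  note nxt = compare_swap_next_edge[OF n j quasi_periodic_sweep[OF F] x, unfolded act]
  define w where "w = (if j + 1 = n then 0 else j + 1)"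
  define off where "off = (if j + 1 = n then n else 0)"
  define sw where "sw \<longleftrightarrow> odd ((t + j) mod n) \<and> ?x w + off < ?x j"
  note res = res[folded w_def off_def, folded sw_def]
  have sw: "sw \<longleftrightarrow> swapped (active (int n) t) ?G (int j)"
    using nxt(1) unfolding sw_def w_def off_def .
  have "represents n (arr (result edge_body s) ''x'')
      (compare_swap (active_below (int n) t (Suc j)) ?G)"
    unfolding represents_def res(1) using nxt(2) unfolding sw_def w_def off_def by blast
  moreover have "arr (result edge_body s) ''out'' m = (if m < t * n + Suc j then edge_bit n F m else 0)" for m
  proof (cases "m = t * n + j")
    case True
    have "edge_bit n F m = (if sw then 1 else 0)" unfolding sw True using j by (simp add: edge_bit_def)
    moreover have "arr (result edge_body s) ''out'' m = (if sw then 1 else 0)"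
      unfolding res(2) using True out[of m] by simp
    ultimately show ?thesis using True by simp
  next
    case False
    then have "m < t * n + Suc j \<longleftrightarrow> m < t * n + j" by linarith
    then show ?thesis unfolding res(2) using False out[of m] by simp
  qed
  ultimately show ?thesis
    using res(3-9) unfolding edge_inv_def by simp
qed

lemma compare_swap_active_below_0:
  "n > 0 \<Longrightarrow> compare_swap (active_below (int n) t 0) F = F"
  by (rule ext) (simp add: compare_swap_def swapped_def active_below_def not_less)

lemma compare_swap_active_below_all:
  "n > 0 \<Longrightarrow> compare_swap (active_below (int n) t n) F = compare_swap (active (int n) t) F"
  by (rule ext) (simp add: compare_swap_def swapped_def active_below_def)

lemma round_inv_step:
  assumes n: "n \<ge> 3" and F: "quasi_periodic (int n) F" and inv: "round_inv n F R t s"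
  shows "runs round_body s (50 * n + 20) (round_inv n F R (Suc t))"
proof -
  have n0: "n > 0" using n by simp
  let ?loop = "While (Less (Reg ''j'') (Reg ''inlen'')) edge_body"
  have "runs (Assign ''j'' (Const 0)) s 1 (edge_inv n F R t 0)"
    using inv runs_loop_free[of "Assign ''j'' (Const 0)" "edge_inv n F R t 0" s]
    by (simp add: edge_inv_def round_inv_def memory_simps compare_swap_active_below_0[OF n0])
  moreover have "runs ?loop s' (n * (cost edge_body + 1) + 1) (edge_inv n F R t n)"
    if "edge_inv n F R t 0 s'" for s'
  proof (rule runs_While[where I = "edge_inv n F R t", OF that])
    fix k s assume k: "k < n" and I: "edge_inv n F R t k s"
      have "bval (Less (Reg ''j'') (Reg ''inlen'')) s"
        using k I by (simp add: edge_inv_def)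
      then show "bval (Less (Reg ''j'') (Reg ''inlen'')) s \<and> runs edge_body s (cost edge_body) (edge_inv n F R t (Suc k))"
        using runs_loop_free[OF loop_free_bodies(1), of "edge_inv n F R t (Suc k)" s] edge_inv_step[OF n F k I] by blast
  qed (simp add: edge_inv_def)
  moreover have "runs (Seq advance (incr ''t'')) s' (cost (Seq advance (incr ''t''))) (round_inv n F R (Suc t))"
    if e: "edge_inv n F R t n s'" for s'
  proof (rule runs_loop_free)
    have i: "reg s' ''inlen'' = n" "reg s' ''r'' = t mod n" "reg s' ''b'' = t mod n mod 2"
      using e by (simp_all add: edge_inv_def)
    show "round_inv n F R (Suc t) (result (Seq advance (incr ''t'')) s')"
      using e by (simp add: advance_result[OF n i] incr_def memory_simps round_inv_def edge_inv_def
          compare_swap_active_below_all[OF n0] algebra_simps)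
  qed (rule loop_free_bodies)
  ultimately have "runs round_body s (1 + ((n * (cost edge_body + 1) + 1) + cost (Seq advance (incr ''t''))))
     (round_inv n F R (Suc t))"
    unfolding round_body_def by (blast intro: runs_Seq)
  moreover have "n * (cost edge_body + 1) \<le> n * 31" using cost_bodies(1) by (intro mult_left_mono) simp_all
  ultimately show ?thesis
    using cost_bodies(4)[of "''t''"] by (elim runs_mono) (linarith, assumption)
qed

lemma rounds_loop:
  assumes n: "n \<ge> 3" and F: "quasi_periodic (int n) F" and inv: "round_inv n F R 0 s"
  shows "runs (While (Less (Reg ''t'') (Reg ''rounds'')) round_body) s
    (R * (50 * n + 21) + 1) (round_inv n F R R)"
proof -
  have "runs (While (Less (Reg ''t'') (Reg ''rounds'')) round_body) s
    (R * (50 * n + 20 + 1) + 1) (round_inv n F R R)"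
  proof (rule runs_While[where I = "round_inv n F R", OF inv])
    fix k s assume k: "k < R" and I: "round_inv n F R k s"
    then show "bval (Less (Reg ''t'') (Reg ''rounds'')) s \<and>
        runs round_body s (50 * n + 20) (round_inv n F R (Suc k))"
      using round_inv_step[OF n F I] by (simp add: round_inv_def[of n F R k])
  qed (simp add: round_inv_def)
  then show ?thesis by (simp add: algebra_simps)
qed

section \<open>The measuring phase and the choice of the lift\<close>

definition fresh :: "nat \<Rightarrow> (nat \<Rightarrow> nat) \<Rightarrow> memory \<Rightarrow> bool" where
  "fresh n C s \<longleftrightarrow> reg s ''inlen'' = n \<and> reg s ''outlen'' = 0 \<and> reg s ''t'' = 0 \<and> reg s ''r'' = 0 \<and>
     reg s ''b'' = 0 \<and> arr s ''out'' = (\<lambda>_. 0) \<and> (\<forall>i<n. arr s ''in'' i = C (i + 1))"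

definition measure_inv :: "nat \<Rightarrow> (nat \<Rightarrow> nat) \<Rightarrow> nat \<Rightarrow> memory \<Rightarrow> bool" where
  "measure_inv n C i s \<longleftrightarrow> fresh n C s \<and> reg s ''i'' = i \<and>
     (\<forall>p<i. int (arr s ''x'' p) = nearest n C p + int n) \<and>
     int (reg s ''sumx'') = (\<Sum>p<i. nearest n C p + int n) \<and>
     int (reg s ''sumz'') = (\<Sum>p<i. int p + int n) \<and>
     reg s ''dev'' = Max (insert 0 ((\<lambda>p. nat \<bar>nearest n C p - int p\<bar>) ` {..<i}))"

lemma configuration_pos:
  "is_configuration (cycle_vertices n) C \<Longrightarrow> p < n \<Longrightarrow> 1 \<le> C (p + 1) \<and> C (p + 1) \<le> n"
  using configuration_range[of n C p] by (simp add: plain_def)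

lemma measure_body_result:
  fixes s :: memory
  defines "i \<equiv> reg s ''i''" and "n \<equiv> reg s ''inlen''"
  defines "c \<equiv> arr s ''in'' i"
  defines "v \<equiv> (if c + c < i + i + (2 + n) then if c + c + n < i + i + 2 then c + (n + n) - 1 else c + n - 1 else c - 1)"
  shows "result measure_body s =
    s\<lparr>reg := (reg s)(''z'' := i + n, ''d'' := (v - (i + n)) + ((i + n) - v),
        ''dev'' := max (reg s ''dev'') ((v - (i + n)) + ((i + n) - v)),
        ''sumx'' := reg s ''sumx'' + v, ''sumz'' := reg s ''sumz'' + (i + n), ''i'' := Suc i),
      arr := (arr s)(''x'' := (arr s ''x'')(i := v))\<rparr>"
proof -
  define s1 where "s1 = s\<lparr>arr := (arr s)(''x'' := (arr s ''x'')(i := v))\<rparr>"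
  have 1: "result (Cond (Less (Add (Cell ''in'' (Reg ''i'')) (Cell ''in'' (Reg ''i'')))
             (Add (Add (Reg ''i'') (Reg ''i'')) (Add (Const 2) (Reg ''inlen''))))
       (Cond (Less (Add (Add (Cell ''in'' (Reg ''i'')) (Cell ''in'' (Reg ''i''))) (Reg ''inlen''))
               (Add (Add (Reg ''i'') (Reg ''i'')) (Const 2)))
         (Store ''x'' (Reg ''i'') (Monus (Add (Cell ''in'' (Reg ''i'')) (Add (Reg ''inlen'') (Reg ''inlen''))) (Const 1)))
         (Store ''x'' (Reg ''i'') (Monus (Add (Cell ''in'' (Reg ''i'')) (Reg ''inlen'')) (Const 1))))
       (Store ''x'' (Reg ''i'') (Monus (Cell ''in'' (Reg ''i'')) (Const 1)))) s = s1"
    by (simp add: s1_def v_def memory_simps flip: i_def n_def c_def)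
  let ?d = "(v - (i + n)) + ((i + n) - v)"
  have idem: "(reg s)(''z'' := a, ''d'' := b, ''dev'' := reg s ''dev'') = (reg s)(''z'' := a, ''d'' := b)" for a b
    by (rule fun_upd_idem) simp
  show ?thesis
  proof (cases "reg s ''dev'' < ?d")
    case True
    then have m: "max (reg s ''dev'') ?d = ?d" by simp
    show ?thesis
      unfolding measure_body_def seqs_simps result.simps(4) 1 m
      using True by (simp add: s1_def incr_def memory_simps flip: i_def n_def)
  next
    case False
    then have m: "max (reg s ''dev'') ?d = reg s ''dev''" by simp
    show ?thesis
      unfolding measure_body_def seqs_simps result.simps(4) 1 m idem
      using False by (simp add: s1_def incr_def memory_simps flip: i_def n_def)
  qed
qed

lemma measure_inv_step:
  assumes C: "is_configuration (cycle_vertices n) C" and i: "i < n" and inv: "measure_inv n C i s"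
  shows "measure_inv n C (Suc i) (result measure_body s)"
proof -
  let ?c = "arr s ''in'' i"
  define v where "v = (if ?c + ?c < i + i + (2 + n) then
     if ?c + ?c + n < i + i + 2 then ?c + (n + n) - 1 else ?c + n - 1 else ?c - 1)"
  have f: "fresh n C s" and ri: "reg s ''i'' = i" using inv by (simp_all add: measure_inv_def)
  have rn: "reg s ''inlen'' = n" and c: "?c = C (i + 1)" using f i by (simp_all add: fresh_def)
  note res = measure_body_result[of s, unfolded ri rn, folded v_def]
  \<comment> \<open>The tests of the program are those of \<open>nearest\<close>, rearranged so that
    only sums are compared; \<open>C (i + 1) \<ge> 1\<close> keeps the subtraction of 1 from being
    truncated.\<close>
  have v: "int v = nearest n C i + int n"
    using configuration_pos[OF C i] unfolding v_def c nearest_def plain_def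
    by (auto simp: of_nat_diff)
  \<comment> \<open>One of the two truncated differences is 0, so their sum is the absolute
    value.\<close>
  have d: "(v - (i + n)) + ((i + n) - v) = nat \<bar>nearest n C i - int i\<bar>"
    using v by linarith
  have "fresh n C (result measure_body s)"
    using f unfolding res by (simp add: fresh_def)
  moreover have "reg (result measure_body s) ''dev'' =
      Max (insert 0 ((\<lambda>p. nat \<bar>nearest n C p - int p\<bar>) ` {..<Suc i}))"
    using inv unfolding res d
    by (simp add: measure_inv_def lessThan_Suc insert_commute[of 0] max.commute)
  ultimately show ?thesis using inv v unfolding measure_inv_def res by (auto simp: less_Suc_eq)
qed

definition ready :: "nat \<Rightarrow> (nat \<Rightarrow> nat) \<Rightarrow> memory \<Rightarrow> bool" where
  "ready n C = round_inv n (extend n (lifted n C)) (rounds n C) 0"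

lemma ready_iff:
  assumes "fresh n C s"
  shows "ready n C s \<longleftrightarrow> reg s ''rounds'' = rounds n C \<and> (\<forall>p<n. int (arr s ''x'' p) = lifted n C p + int n)"
  using assms by (auto simp: ready_def round_inv_def fresh_def represents_def)

definition copy_inv :: "nat \<Rightarrow> (nat \<Rightarrow> nat) \<Rightarrow> nat \<Rightarrow> memory \<Rightarrow> bool" where
  "copy_inv n C i s \<longleftrightarrow> fresh n C s \<and> reg s ''i'' = i \<and> (\<forall>p<i. int (arr s ''x'' p) = plain C p + int n)"

lemma copy_inv_step:
  assumes C: "is_configuration (cycle_vertices n) C" and i: "i < n" and inv: "copy_inv n C i s"
  shows "copy_inv n C (Suc i) (result copy_body s)"
proof -
  have f: "fresh n C s" using inv by (simp add: copy_inv_def)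
  then have "result copy_body s = s\<lparr>reg := (reg s)(''i'' := Suc i),
      arr := (arr s)(''x'' := (arr s ''x'')(i := C (i + 1) + n - 1))\<rparr>"
    using inv i by (simp add: copy_inv_def fresh_def copy_body_def incr_def memory_simps)
  then show ?thesis using inv f configuration_pos[OF C i]
    by (auto simp: copy_inv_def fresh_def less_Suc_eq plain_def of_nat_diff)
qed

lemma set_rounds_correct:
  assumes C: "is_configuration (cycle_vertices n) C" and n: "n > 0" and inv: "measure_inv n C n s"
  shows "runs (set_rounds (n mod 2)) s (10 * n + 10) (ready n C)"
proof -
  have f: "fresh n C s" using inv by (simp add: measure_inv_def)
  have bal: "reg s ''sumx'' = reg s ''sumz'' \<longleftrightarrow> balanced n C"
  proof -
    have "reg s ''sumx'' = reg s ''sumz'' \<longleftrightarrow> int (reg s ''sumx'') = int (reg s ''sumz'')" by simp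
    then show ?thesis using inv by (simp only: measure_inv_def balanced_def sum.distrib) simp
  qed
  have dev: "reg s ''dev'' = deviation n C"
    using inv n by (simp add: measure_inv_def deviation_def lessThan_empty_iff)
  have "runs (set_rounds (n mod 2)) s ((1 + ((n * (cost copy_body + 1) + 1) + 1)) + 1) (ready n C)"
    unfolding set_rounds_def
  proof (rule runs_Cond)
    assume "bval (Equal (Reg ''sumx'') (Reg ''sumz'')) s"
    then have b: "balanced n C" using bal by simp
    let ?c = "Assign ''rounds'' (Add (Add (Reg ''dev'') (Reg ''dev'')) (Const (n mod 2)))"
    have "fresh n C (result ?c s)" using f by (simp add: fresh_def memory_simps)
    then have "ready n C (result ?c s)"
      using b inv dev by (simp add: ready_iff memory_simps rounds_def lifted_def measure_inv_def)
    then have "runs ?c s (cost ?c) (ready n C)" by (intro runs_loop_free) simp_all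
    then show "runs ?c s (1 + ((n * (cost copy_body + 1) + 1) + 1)) (ready n C)"
      by (rule runs_mono) simp_all
  next
    assume "\<not> bval (Equal (Reg ''sumx'') (Reg ''sumz'')) s"
    then have b: "\<not> balanced n C" using bal by simp
    let ?c = "Assign ''rounds'' (Add (Reg ''inlen'') (Const (n mod 2)))"
    have "runs (Assign ''i'' (Const 0)) s 1 (copy_inv n C 0)"
      using f runs_loop_free[of "Assign ''i'' (Const 0)" "copy_inv n C 0" s]
      by (simp add: copy_inv_def fresh_def memory_simps)
    moreover have "runs (While (Less (Reg ''i'') (Reg ''inlen'')) copy_body) s'
        (n * (cost copy_body + 1) + 1) (copy_inv n C n)" if "copy_inv n C 0 s'" for s'
    proof (rule runs_While[where I = "copy_inv n C", OF that])
      fix k s assume k: "k < n" and I: "copy_inv n C k s"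
      have "bval (Less (Reg ''i'') (Reg ''inlen'')) s"
        using k I by (simp add: copy_inv_def fresh_def)
      then show "bval (Less (Reg ''i'') (Reg ''inlen'')) s \<and> runs copy_body s (cost copy_body) (copy_inv n C (Suc k))"
        using runs_loop_free[OF loop_free_bodies(3), of "copy_inv n C (Suc k)" s] copy_inv_step[OF C k I] by blast
    qed (simp add: copy_inv_def fresh_def)
    moreover have "runs ?c s' 1 (ready n C)" if "copy_inv n C n s'" for s'
    proof -
      have "fresh n C (result ?c s')" using that by (simp add: copy_inv_def fresh_def memory_simps)
      then have "ready n C (result ?c s')"
        using b that by (simp add: ready_iff memory_simps rounds_def lifted_def copy_inv_def fresh_def)
      then show ?thesis using runs_loop_free[of ?c "ready n C" s'] by simp
    qed
    ultimately show "runs (Seq (Assign ''i'' (Const 0)) (Seq (While (Less (Reg ''i'') (Reg ''inlen'')) copy_body) ?c)) s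
      (1 + ((n * (cost copy_body + 1) + 1) + 1)) (ready n C)"
      by (blast intro: runs_Seq)
  qed
  moreover have "n * (cost copy_body + 1) \<le> n * 3" using cost_bodies(3) by (intro mult_left_mono) simp_all
  ultimately show ?thesis by (elim runs_mono) (linarith, assumption)
qed

section \<open>Output and running time of the whole program\<close>

lemma cycle_routing_correct:
  assumes C: "is_configuration (cycle_vertices n) C" and n: "n \<ge> 3"
  defines "R \<equiv> rounds n C"
  shows "runs (cycle_routing (n mod 2)) (input_memory (encode_instance (n, C)))
    ((30 * n + 1) + ((10 * n + 10) + (R * (50 * n + 21) + 1)))
    (round_inv n (extend n (lifted n C)) R R)"
proof -
  let ?s = "input_memory (encode_instance (n, C))"
  have start: "measure_inv n C 0 ?s"
    by (simp add: measure_inv_def fresh_def input_memory_def encode_instance_def nth_append del: upt_Suc)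
  have "runs (While (Less (Reg ''i'') (Reg ''inlen'')) measure_body) ?s
      (n * (cost measure_body + 1) + 1) (measure_inv n C n)"
  proof (rule runs_While[where I = "measure_inv n C", OF start])
    fix k s assume k: "k < n" and I: "measure_inv n C k s"
      have "bval (Less (Reg ''i'') (Reg ''inlen'')) s"
        using k I by (simp add: measure_inv_def fresh_def)
      then show "bval (Less (Reg ''i'') (Reg ''inlen'')) s \<and> runs measure_body s (cost measure_body) (measure_inv n C (Suc k))"
        using runs_loop_free[OF loop_free_bodies(2), of "measure_inv n C (Suc k)" s] measure_inv_step[OF C k I] by blast
  qed (simp add: measure_inv_def fresh_def)
  moreover have "n * (cost measure_body + 1) \<le> n * 30" using cost_bodies(2) by (intro mult_left_mono) simp_all
  ultimately have "runs (While (Less (Reg ''i'') (Reg ''inlen'')) measure_body) ?s (30 * n + 1) (measure_inv n C n)"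
    by (elim runs_mono) simp_all
  moreover have "runs (set_rounds (n mod 2)) s (10 * n + 10) (ready n C)" if "measure_inv n C n s" for s
    using set_rounds_correct[OF C _ that] n by simp
  moreover have "runs (While (Less (Reg ''t'') (Reg ''rounds'')) round_body) s (R * (50 * n + 21) + 1)
      (round_inv n (extend n (lifted n C)) R R)" if "ready n C s" for s
    using rounds_loop[OF n quasi_periodic_extend] that n unfolding ready_def R_def by simp
  ultimately show ?thesis unfolding cycle_routing_def by (blast intro: runs_Seq)
qed

lemma encode_sweep_matchings:
  assumes n: "n \<ge> 3"
  shows "encode_solution n (sweep_matchings n F T) = map (edge_bit n F) [0..<T * n]"
proof (induction T)
  case 0
  then show ?case by (simp add: encode_solution_def sweep_matchings_def)
next
  case (Suc T)
  have "encode_matching n (swap_matching n (active (int n) T) (sweep (int n) F T)) =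
      map (edge_bit n F) [T * n..<T * n + n]"
  proof (rule nth_equalityI)
    fix i assume "i < length (encode_matching n (swap_matching n (active (int n) T) (sweep (int n) F T)))"
    then have i: "i < n" by (simp add: encode_matching_def del: upt_Suc)
    then have "(T * n + i) div n = T" "(T * n + i) mod n = i" by simp_all
    moreover have "cycle_edge n (Suc i) \<in> swap_matching n (active (int n) T) (sweep (int n) F T)
        \<longleftrightarrow> swapped (active (int n) T) (sweep (int n) F T) (int i)"
      using cycle_edge_swap_matching[OF n, of "Suc i"] i by simp
    ultimately show "encode_matching n (swap_matching n (active (int n) T) (sweep (int n) F T)) ! i =
        map (edge_bit n F) [T * n..<T * n + n] ! i"
      using i by (simp add: encode_matching_def edge_bit_def del: upt_Suc)
  qed (simp add: encode_matching_def del: upt_Suc)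
  moreover have "[0..<Suc T * n] = [0..<T * n] @ [T * n..<T * n + n]"
    using upt_add_eq_append[of 0 "T * n" n] by (simp add: add.commute)
  ultimately show ?case using Suc by (simp add: encode_solution_def sweep_matchings_def)
qed

lemma input_size_ge: "n \<le> input_size (encode_instance (n, C))"
proof -
  have "length xs \<le> input_size xs" for xs by (induction xs) (simp_all add: input_size_def)
  from this[of "encode_instance (n, C)"] show ?thesis by (simp add: encode_instance_def del: upt_Suc)
qed

lemma cycle_routing_poly_time:
  "poly_time_algorithm (cycle_routing e) encode_instance
     {(n, C). n \<ge> 3 \<and> n mod 2 = e \<and> is_configuration (cycle_vertices n) C}
     (\<lambda>(n, C) ys. \<exists>Ms. ys = encode_solution n Ms \<and>
        is_solution (cycle_vertices n) (cycle_edges n) C Ms \<and>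
        length Ms \<le> 2 * OPT (cycle_vertices n) (cycle_edges n) C + e)"
  unfolding poly_time_algorithm_def
\<comment> \<open>The coefficients come from expanding the time bound of
  \<open>cycle_routing_correct\<close> with at most \<open>n + 1\<close> rounds; \<open>n\<close> in
  turn is at most the input size, since every entry has at least one digit.\<close>
proof (intro exI[of _ "[:33, 111, 50:]"] ballI, clarify)
  fix n C assume n: "3 \<le> n" and C: "is_configuration (cycle_vertices n) C" and e: "e = n mod 2"
  let ?R = "rounds n C" and ?F = "extend n (lifted n C)" and ?m = "input_size (encode_instance (n, C))"
  let ?Ms = "sweep_matchings n ?F ?R"
  obtain t s where ex: "exec (cycle_routing (n mod 2)) (input_memory (encode_instance (n, C))) t s"
    and t: "t \<le> (30 * n + 1) + ((10 * n + 10) + (?R * (50 * n + 21) + 1))"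
    and inv: "round_inv n ?F ?R ?R s"
    using cycle_routing_correct[OF C n] unfolding runs_def by blast
  have "output_list s = map (edge_bit n ?F) [0..<?R * n]"
    using inv by (simp add: output_list_def round_inv_def)
  then have out: "output_list s = encode_solution n ?Ms" using encode_sweep_matchings[OF n] by simp
  have "?R * (50 * n + 21) \<le> (n + 1) * (50 * n + 21)"
    using rounds_le[OF C] n by (intro mult_right_mono) simp_all
  then have "t \<le> 33 + n * (111 + n * 50)" using t by (simp add: algebra_simps)
  also have "\<dots> \<le> 33 + ?m * (111 + ?m * 50)" using input_size_ge by (intro add_mono mult_mono) simp_all
  finally have "t \<le> poly [:33, 111, 50:] ?m" by simp
  then show "\<exists>ys t. computes_in (cycle_routing (n mod 2)) (encode_instance (n, C)) ys t \<and>
      t \<le> poly [:33, 111, 50:] ?m \<and>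
      (\<exists>Ms. ys = encode_solution n Ms \<and> is_solution (cycle_vertices n) (cycle_edges n) C Ms \<and>
        length Ms \<le> 2 * OPT (cycle_vertices n) (cycle_edges n) C + n mod 2)"
    using ex out rounds_solution[OF C n] unfolding computes_in_def by blast
qed

theorem theorem2:
  shows
    "(\<exists>A. poly_time_algorithm A encode_instance
           {(n, C). n \<ge> 3 \<and> even n \<and> is_configuration (cycle_vertices n) C}
           (\<lambda>(n, C) ys. \<exists>Ms. ys = encode_solution n Ms \<and>
              is_solution (cycle_vertices n) (cycle_edges n) C Ms \<and>
              length Ms \<le> 2 * OPT (cycle_vertices n) (cycle_edges n) C))
     \<and>
     (\<exists>A. poly_time_algorithm A encode_instance
           {(n, C). n \<ge> 3 \<and> odd n \<and> is_configuration (cycle_vertices n) C}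
           (\<lambda>(n, C) ys. \<exists>Ms. ys = encode_solution n Ms \<and>
              is_solution (cycle_vertices n) (cycle_edges n) C Ms \<and>
              length Ms \<le> 2 * OPT (cycle_vertices n) (cycle_edges n) C + 1))"
  using cycle_routing_poly_time[of 0, unfolded add_0_right, folded even_iff_mod_2_eq_zero]
    cycle_routing_poly_time[of 1, folded odd_iff_mod_2_eq_one] by blast

end
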